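(* One can recover $r$, the number of non-trivial rooted trees attached to the cycle, from the chromatic symmetric function of a connected unicyclic graph whenever $1<r<c$, where $c$ is the size of the cycle. That is: if $G$ is a connected unicyclic graph with cycle of size $c$ and $r$ non-trivial rooted trees with $1<r<c$, and $H$ is any connected unicyclic graph with $\mathbf{X}_H=\mathbf{X}_G$, then $H$ also has exactly $r$ non-trivial rooted trees attached to its cycle.
   Context: All graphs are finite and simple. The chromatic symmetric function of a graph $G$ with vertices $v_1,\dots,v_n$ is $\mathbf{X}_G=\sum_\kappa x_{\kappa(v_1)}\cdots x_{\kappa(v_n)}$, summed over all proper colorings $\kappa:V(G)\to\mathbb{N}$. A unicyclic graph is a graph containing exactly one cycle. If $G$ is connected unicyclic with cycle vertices $v_1,\dots,v_c$, then deleting the edges of the cycle leaves $c$ trees $T_1,\dots,T_c$ with $T_i$ containing (and rooted at) $v_i$; $T_i$ is non-trivial if it has more than one vertex. *)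

theory Defs
  imports
    "Graph_Theory.Graph_Theory"
    "HOL-Library.Poly_Mapping"
    "HOL-Library.FuncSet"
begin

text \<open>
  Finite simple graphs are represented by the locale predicate \<open>pair_graph\<close>, where an
  undirected edge \<open>uv\<close> is the pair of opposite arcs \<open>(u,v)\<close> and \<open>(v,u)\<close>.
\<close>

definition proper_colorings :: "'a pair_pre_digraph \<Rightarrow> ('a \<Rightarrow> nat) set" where
  "proper_colorings G =
     {\<kappa> \<in> pverts G \<rightarrow>\<^sub>E UNIV. \<forall>(u, v) \<in> parcs G. \<kappa> u \<noteq> \<kappa> v}"

definition coloring_monomial :: "'a pair_pre_digraph \<Rightarrow> ('a \<Rightarrow> nat) \<Rightarrow> (nat \<Rightarrow>\<^sub>0 nat)" where
  "coloring_monomial G \<kappa> = (\<Sum>v\<in>pverts G. Poly_Mapping.single (\<kappa> v) 1)"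

text \<open>
  A formal power series in the variables \<open>x\<^sub>0, x\<^sub>1, \<dots>\<close> with integer coefficients is a function
  from exponent vectors of finite support (monomials) to coefficients. A formal sum of monomials
  is then the function counting how often each monomial occurs in the sum; by the lemma below
  each of these counts is finite.
\<close>

definition chromatic_symmetric_function :: "'a pair_pre_digraph \<Rightarrow> (nat \<Rightarrow>\<^sub>0 nat) \<Rightarrow> int" where
  "chromatic_symmetric_function G =
     (\<lambda>m. int (card {\<kappa> \<in> proper_colorings G. coloring_monomial G \<kappa> = m}))"

lemma finite_colorings_of_monomial:
  assumes "finite (pverts G)"
  shows "finite {\<kappa> \<in> proper_colorings G. coloring_monomial G \<kappa> = m}"
proof (rule finite_subset)
  show "{\<kappa> \<in> proper_colorings G. coloring_monomial G \<kappa> = m} \<subseteq> pverts G \<rightarrow>\<^sub>E Poly_Mapping.keys m"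
  proof (rule subsetI)
    fix \<kappa> assume "\<kappa> \<in> {\<kappa> \<in> proper_colorings G. coloring_monomial G \<kappa> = m}"
    then have ext: "\<kappa> \<in> pverts G \<rightarrow>\<^sub>E UNIV" and m: "coloring_monomial G \<kappa> = m"
      by (auto simp: proper_colorings_def)
    have "\<kappa> v \<in> Poly_Mapping.keys m" if "v \<in> pverts G" for v
    proof -
      have "Poly_Mapping.lookup m (\<kappa> v)
          = (\<Sum>w\<in>pverts G. Poly_Mapping.lookup (Poly_Mapping.single (\<kappa> w) 1) (\<kappa> v))"
        unfolding m[symmetric] coloring_monomial_def by (rule lookup_sum)
      also have "\<dots> \<ge> Poly_Mapping.lookup (Poly_Mapping.single (\<kappa> v) (1::nat)) (\<kappa> v)"
        using assms that
        by (intro member_le_sum[where f = "\<lambda>w. Poly_Mapping.lookup (Poly_Mapping.single (\<kappa> w) (1::nat)) (\<kappa> v)"]) auto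
      finally show ?thesis by (simp add: in_keys_iff)
    qed
    with ext show "\<kappa> \<in> pverts G \<rightarrow>\<^sub>E Poly_Mapping.keys m"
      by (auto simp: PiE_def)
  qed
  show "finite (pverts G \<rightarrow>\<^sub>E Poly_Mapping.keys m)"
    using assms by (intro finite_PiE) auto
qed

text \<open>
  The constant \<open>pre_digraph.cycle\<close> is about directed closed walks: it accepts the walk \<open>uvu\<close>
  along a single edge, and distinguishes starting points and orientations. The cycles of an
  undirected graph are therefore taken to be subgraphs, traced by such walks of length at least 3.
\<close>

definition cycle_in :: "'a pair_pre_digraph \<Rightarrow> 'a pair_pre_digraph \<Rightarrow> bool" where
  "cycle_in G C \<longleftrightarrow>
     (\<exists>p. pre_digraph.cycle (with_proj G) p \<and> 3 \<le> length p \<and>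
          C = \<lparr>pverts = fst ` set p, parcs = set p \<union> (set p)\<inverse>\<rparr>)"

definition unicyclic :: "'a pair_pre_digraph \<Rightarrow> bool" where
  "unicyclic G \<longleftrightarrow> (\<exists>!C. cycle_in G C)"

definition the_cycle :: "'a pair_pre_digraph \<Rightarrow> 'a pair_pre_digraph" where
  "the_cycle G = (THE C. cycle_in G C)"

definition cycle_size :: "'a pair_pre_digraph \<Rightarrow> nat" where
  "cycle_size G = card (pverts (the_cycle G))"

definition delete_cycle_edges :: "'a pair_pre_digraph \<Rightarrow> 'a pair_pre_digraph" where
  "delete_cycle_edges G = G\<lparr>parcs := parcs G - parcs (the_cycle G)\<rparr>"

text \<open>
  As \<open>delete_cycle_edges G\<close> is symmetric, \<open>scc_of\<close> yields the vertex set of a connected component.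
\<close>

definition attached_tree :: "'a pair_pre_digraph \<Rightarrow> 'a \<Rightarrow> ('a, 'a \<times> 'a) pre_digraph" where
  "attached_tree G v =
     with_proj (delete_cycle_edges G) \<restriction> pre_digraph.scc_of (with_proj (delete_cycle_edges G)) v"

definition num_nontrivial_trees :: "'a pair_pre_digraph \<Rightarrow> nat" where
  "num_nontrivial_trees G =
     card {v \<in> pverts (the_cycle G). 1 < card (verts (attached_tree G v))}"

end

theory Submission
  imports Defs
begin

text \<open>
  Counting colorings by restricting the support of the monomials, \<open>X\<^sub>G\<close> determines the number \<open>n\<close> of
  vertices, the number \<open>2^n + (-1)^c 2^(n-c+1)\<close> of proper 3-colorings, hence the cycle size \<open>c\<close>, and,
  for every \<open>t\<close>, the number of proper colorings with colors \<open>0, \<dots>, t\<close> that use 0 exactly once. The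
  latter is the sum over all vertices \<open>v\<close> of the number of \<open>t\<close>-colorings of \<open>G - v\<close>.

  Take \<open>t = c - 1\<close>. Since \<open>G\<close> arises from its cycle by attaching pendant vertices, the summand of a
  cycle vertex carrying a trivial tree is \<open>t (t-1)^(n-2)\<close>, as \<open>G - v\<close> is a tree. Every other summand
  is divisible by \<open>t\<^sup>2\<close>: either \<open>G - v\<close> is disconnected, or it still contains the cycle, whose number
  \<open>(t-1)^c + (-1)^c (t-1)\<close> of \<open>t\<close>-colorings is divisible by \<open>t\<^sup>2\<close> for this choice of \<open>t\<close>. So \<open>X\<^sub>G\<close>
  determines \<open>(c - r) t (t-1)^(n-2)\<close> modulo \<open>t\<^sup>2\<close>, that is, \<open>r\<close> modulo \<open>c - 1\<close>. For \<open>1 < r < c\<close> the only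
  other candidate in \<open>{0..c}\<close> is 0, for \<open>r = c - 1\<close>, and 0 occurs only if \<open>n = c\<close>.
\<close>

section \<open>Counting colorings\<close>

text \<open>Testing adjacency only inside \<open>U\<close> makes these the colorings of an induced
  subgraph, so vertices are deleted and added by changing \<open>U\<close> while \<open>R\<close>
  stays fixed.\<close>

definition colorings :: "'a rel \<Rightarrow> 'a set \<Rightarrow> nat set \<Rightarrow> ('a \<Rightarrow> nat) set" where
  "colorings R U A = {\<kappa> \<in> U \<rightarrow>\<^sub>E A. \<forall>u\<in>U. \<forall>v\<in>U. (u, v) \<in> R \<longrightarrow> \<kappa> u \<noteq> \<kappa> v}"

lemma finite_colorings: "finite U \<Longrightarrow> finite A \<Longrightarrow> finite (colorings R U A)"
  unfolding colorings_def by (rule finite_subset[OF _ finite_PiE[of U "\<lambda>_. A"]]) auto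

lemma colorings_cong:
  assumes "\<And>u v. u \<in> U \<Longrightarrow> v \<in> U \<Longrightarrow> (u, v) \<in> R \<longleftrightarrow> (u, v) \<in> R'"
  shows "colorings R U A = colorings R' U A"
  using assms by (auto simp: colorings_def)

text \<open>A coloring of the larger set splits into its restriction to \<open>U\<close> and the
  color of \<open>x\<close>, and the latter only has to avoid the colors of the neighbours of
  \<open>x\<close>.\<close>

lemma colorings_insert_bij:
  assumes "sym R" "(x, x) \<notin> R" "x \<notin> U"
  shows "bij_betw (\<lambda>(\<kappa>, a). \<kappa>(x := a))
    (SIGMA \<kappa>:colorings R U A. A - \<kappa> ` {y \<in> U. (x, y) \<in> R}) (colorings R (insert x U) A)"
proof (intro bij_betw_byWitness[where f' = "\<lambda>\<kappa>. (restrict \<kappa> U, \<kappa> x)"])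
  show "\<forall>p\<in>SIGMA \<kappa>:colorings R U A. A - \<kappa> ` {y \<in> U. (x, y) \<in> R}.
      (\<lambda>\<kappa>. (restrict \<kappa> U, \<kappa> x)) ((\<lambda>(\<kappa>, a). \<kappa>(x := a)) p) = p"
    using assms(3) by (auto simp: colorings_def fun_eq_iff PiE_def extensional_def)
  show "\<forall>\<kappa>\<in>colorings R (insert x U) A.
      (\<lambda>(\<kappa>, a). \<kappa>(x := a)) ((\<lambda>\<kappa>. (restrict \<kappa> U, \<kappa> x)) \<kappa>) = \<kappa>"
    by (auto simp: colorings_def fun_eq_iff PiE_def extensional_def)
  have sym: "(u, x) \<in> R \<longleftrightarrow> (x, u) \<in> R" for u
    using assms(1) by (auto dest: symD)
  have "\<kappa>(x := a) \<in> colorings R (insert x U) A"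
    if \<kappa>: "\<kappa> \<in> colorings R U A" and a: "a \<in> A - \<kappa> ` {y \<in> U. (x, y) \<in> R}" for \<kappa> a
  proof -
    have "(\<kappa>(x := a)) u \<noteq> (\<kappa>(x := a)) w"
      if "u \<in> insert x U" "w \<in> insert x U" "(u, w) \<in> R" for u w
      using that sym[of u] assms(2) \<kappa> a by (cases "u = x"; cases "w = x") (auto simp: colorings_def)
    moreover have "\<kappa>(x := a) \<in> insert x U \<rightarrow>\<^sub>E A"
      using \<kappa> a by (auto simp: colorings_def PiE_iff extensional_def)
    ultimately show ?thesis unfolding colorings_def by blast
  qed
  then show "(\<lambda>(\<kappa>, a). \<kappa>(x := a)) ` (SIGMA \<kappa>:colorings R U A. A - \<kappa> ` {y \<in> U. (x, y) \<in> R})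
      \<subseteq> colorings R (insert x U) A"
    by (intro image_subsetI) (force simp only: mem_Sigma_iff split: prod.splits)
  have "restrict \<kappa> U \<in> colorings R U A \<and> \<kappa> x \<in> A - \<kappa> ` {y \<in> U. (x, y) \<in> R}"
    if "\<kappa> \<in> colorings R (insert x U) A" for \<kappa>
  proof -
    have "\<kappa> \<in> insert x U \<rightarrow>\<^sub>E A" "\<And>u w. u \<in> insert x U \<Longrightarrow> w \<in> insert x U \<Longrightarrow> (u, w) \<in> R \<Longrightarrow> \<kappa> u \<noteq> \<kappa> w"
      using that by (auto simp: colorings_def)
    then show ?thesis
      by (simp add: colorings_def PiE_iff) blast
  qed
  moreover have "restrict \<kappa> U ` {y \<in> U. (x, y) \<in> R} = \<kappa> ` {y \<in> U. (x, y) \<in> R}" for \<kappa> :: "'a \<Rightarrow> nat"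
    by (intro image_cong) auto
  ultimately show "(\<lambda>\<kappa>. (restrict \<kappa> U, \<kappa> x)) ` colorings R (insert x U) A
      \<subseteq> (SIGMA \<kappa>:colorings R U A. A - \<kappa> ` {y \<in> U. (x, y) \<in> R})"
    by (simp add: image_subset_iff)
qed

lemma card_colorings_insert:
  assumes "sym R" "(x, x) \<notin> R" "x \<notin> U" "finite U" "finite A"
  shows "card (colorings R (insert x U) A)
    = (\<Sum>\<kappa>\<in>colorings R U A. card (A - \<kappa> ` {y \<in> U. (x, y) \<in> R}))"
proof -
  have "card (colorings R (insert x U) A)
      = card (SIGMA \<kappa>:colorings R U A. A - \<kappa> ` {y \<in> U. (x, y) \<in> R})"
    using bij_betw_same_card[OF colorings_insert_bij[OF assms(1-3)]] by simp
  then show ?thesis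
    using assms by (simp add: card_SigmaI finite_colorings)
qed

lemma card_colorings_insert_isolated:
  assumes "sym R" "(x, x) \<notin> R" "x \<notin> U" "finite U" "finite A" "{y \<in> U. (x, y) \<in> R} = {}"
  shows "card (colorings R (insert x U) A) = card A * card (colorings R U A)"
  unfolding card_colorings_insert[OF assms(1-5)] assms(6) by simp

text \<open>The new vertex has \<open>card A - 2\<close> choices if \<open>a\<close> and
  \<open>b\<close> get different colors and \<open>card A - 1\<close> otherwise; adding one for each
  coloring that separates them evens this out. The case \<open>a = b\<close> is allowed and covers
  pendant vertices.\<close>

lemma card_colorings_insert_two:
  assumes "sym R" "(x, x) \<notin> R" "x \<notin> U" "finite U" "finite A"
    and nbrs: "{y \<in> U. (x, y) \<in> R} = {a, b}"
  shows "card (colorings R (insert x U) A) + card {\<kappa> \<in> colorings R U A. \<kappa> a \<noteq> \<kappa> b}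
    = (card A - 1) * card (colorings R U A)"
proof -
  have ab: "a \<in> U" "b \<in> U" using nbrs by auto
  have "card (A - \<kappa> ` {a, b}) + (if \<kappa> a \<noteq> \<kappa> b then 1 else 0) = card A - 1"
    if "\<kappa> \<in> colorings R U A" for \<kappa>
  proof -
    have "\<kappa> a \<in> A" "\<kappa> b \<in> A"
      using that ab by (auto simp: colorings_def)
    moreover have "card (A - {\<kappa> a, \<kappa> b}) = card A - card {\<kappa> a, \<kappa> b}"
      using calculation by (intro card_Diff_subset) auto
    moreover have "card {\<kappa> a, \<kappa> b} \<le> card A"
      using calculation assms(5) by (intro card_mono) auto
    ultimately show ?thesis
      by (auto simp: card_insert_if split: if_splits)
  qed
  then have "(\<Sum>\<kappa>\<in>colorings R U A. card (A - \<kappa> ` {a, b}) + (if \<kappa> a \<noteq> \<kappa> b then 1 else 0))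
      = (\<Sum>\<kappa>\<in>colorings R U A. card A - 1)"
    by (intro sum.cong) auto
  moreover have "(\<Sum>\<kappa>\<in>colorings R U A. if \<kappa> a \<noteq> \<kappa> b then 1 else 0)
      = card {\<kappa> \<in> colorings R U A. \<kappa> a \<noteq> \<kappa> b}"
    using finite_colorings[OF assms(4,5)] by (simp add: sum.If_cases Int_def)
  ultimately show ?thesis
    unfolding card_colorings_insert[OF assms(1-5)] nbrs by (simp add: sum.distrib)
qed

lemma card_colorings_insert_pendant:
  assumes "sym R" "(x, x) \<notin> R" "x \<notin> U" "finite U" "finite A"
    and "{y \<in> U. (x, y) \<in> R} = {a}"
  shows "card (colorings R (insert x U) A) = (card A - 1) * card (colorings R U A)"
  using card_colorings_insert_two[OF assms(1-5), of a a] assms(6) by simp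

section \<open>Colorings that use the color 0 exactly once\<close>

text \<open>Deleting the unique vertex \<open>v\<close> of color 0 leaves a coloring of
  \<open>U - {v}\<close> with positive colors. Conversely, \<open>v\<close> can always be given 0,
  because no neighbour has that color.\<close>

lemma card_colorings_zero_once:
  assumes "finite U" "irrefl R"
  shows "card {\<kappa> \<in> colorings R U {0..t}. card {v \<in> U. \<kappa> v = 0} = 1}
    = (\<Sum>v\<in>U. card (colorings R (U - {v}) {1..t}))"
proof -
  define S where "S v = {\<kappa> \<in> colorings R U {0..t}. {w \<in> U. \<kappa> w = 0} = {v}}" for v
  have "card (S v) = card (colorings R (U - {v}) {1..t})" if v: "v \<in> U" for v
  proof -
    have "bij_betw (\<lambda>\<kappa>. restrict \<kappa> (U - {v})) (S v) (colorings R (U - {v}) {1..t})"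
    proof (intro bij_betw_byWitness[where f' = "\<lambda>\<kappa>. \<kappa>(v := 0)"])
      show "\<forall>\<kappa>\<in>S v. (restrict \<kappa> (U - {v}))(v := 0) = \<kappa>"
      proof
        fix \<kappa> assume "\<kappa> \<in> S v"
        then have "\<kappa> \<in> extensional U" "\<kappa> v = 0"
          by (auto simp: S_def colorings_def PiE_def)
        then show "(restrict \<kappa> (U - {v}))(v := 0) = \<kappa>"
          by (simp add: fun_eq_iff extensional_def)
      qed
      show "\<forall>\<kappa>\<in>colorings R (U - {v}) {1..t}. restrict (\<kappa>(v := 0)) (U - {v}) = \<kappa>"
      proof
        fix \<kappa> assume "\<kappa> \<in> colorings R (U - {v}) {1..t}"
        then have "\<kappa> \<in> extensional (U - {v})"
          by (auto simp: colorings_def PiE_def)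
        then show "restrict (\<kappa>(v := 0)) (U - {v}) = \<kappa>"
          by (auto simp: fun_eq_iff extensional_def)
      qed
      have "\<kappa> w \<in> {1..t}" if "\<kappa> \<in> S v" "w \<in> U - {v}" for \<kappa> w
      proof -
        have "\<kappa> w \<noteq> 0" "\<kappa> w \<in> {0..t}"
          using that by (auto simp: S_def colorings_def)
        then show ?thesis by auto
      qed
      then have "restrict \<kappa> (U - {v}) \<in> colorings R (U - {v}) {1..t}" if "\<kappa> \<in> S v" for \<kappa>
        using that by (simp add: S_def colorings_def PiE_iff)
      then show "(\<lambda>\<kappa>. restrict \<kappa> (U - {v})) ` S v \<subseteq> colorings R (U - {v}) {1..t}"
        by blast
      have "\<kappa>(v := 0) \<in> S v" if "\<kappa> \<in> colorings R (U - {v}) {1..t}" for \<kappa>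
      proof -
        have pos: "\<kappa> w \<noteq> 0 \<and> \<kappa> w \<le> t" if "w \<in> U" "w \<noteq> v" for w
          using that PiE_mem[of \<kappa> "U - {v}" "\<lambda>_. {1..t}" w] \<open>\<kappa> \<in> _\<close>
          by (auto simp: colorings_def)
        have "(v, v) \<notin> R" using assms(2) by (auto simp: irrefl_def)
        have "w = v" if "w \<in> U" "\<kappa> w = 0" for w
          using pos[of w] that by auto
        with v have "{w \<in> U. (\<kappa>(v := 0)) w = 0} = {v}"
          by auto
        moreover have "\<kappa>(v := 0) \<in> U \<rightarrow>\<^sub>E {0..t}"
          using v that pos by (auto simp: colorings_def PiE_iff extensional_def)
        moreover have "(\<kappa>(v := 0)) u \<noteq> (\<kappa>(v := 0)) w" if uw: "u \<in> U" "w \<in> U" "(u, w) \<in> R" for u w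
        proof (cases "u = v \<or> w = v")
          case True
          with uw \<open>(v, v) \<notin> R\<close> have "u \<noteq> w" by auto
          with True show ?thesis using pos[of u] pos[of w] uw by auto
        next
          case False
          then show ?thesis using uw \<open>\<kappa> \<in> _\<close> by (simp add: colorings_def)
        qed
        ultimately show ?thesis
          by (simp add: S_def colorings_def)
      qed
      then show "(\<lambda>\<kappa>. \<kappa>(v := 0)) ` colorings R (U - {v}) {1..t} \<subseteq> S v"
        by blast
    qed
    then show ?thesis by (rule bij_betw_same_card)
  qed
  moreover have "{\<kappa> \<in> colorings R U {0..t}. card {v \<in> U. \<kappa> v = 0} = 1} = (\<Union>v\<in>U. S v)"
  proof (intro equalityI subsetI)
    fix \<kappa> assume \<kappa>: "\<kappa> \<in> {\<kappa> \<in> colorings R U {0..t}. card {v \<in> U. \<kappa> v = 0} = 1}"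
    then have "card {v \<in> U. \<kappa> v = 0} = 1" by simp
    then obtain v where v: "{v \<in> U. \<kappa> v = 0} = {v}"
      by (rule card_1_singletonE)
    then have "v \<in> U" by blast
    with v \<kappa> show "\<kappa> \<in> (\<Union>v\<in>U. S v)" by (auto simp: S_def)
  qed (auto simp: S_def)
  moreover have "card (\<Union>v\<in>U. S v) = (\<Sum>v\<in>U. card (S v))"
  proof (rule card_UN_disjoint)
    show "\<forall>v\<in>U. finite (S v)"
      using finite_colorings[OF assms(1), of "{0..t}" R] by (simp add: S_def)
    show "\<forall>v\<in>U. \<forall>w\<in>U. v \<noteq> w \<longrightarrow> S v \<inter> S w = {}"
      by (auto simp: S_def)
  qed (rule assms(1))
  ultimately show ?thesis by simp
qed

section \<open>Growth by pendant vertices\<close>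

text \<open>\<open>W\<close> arises from \<open>C\<close> by successively attaching pendant vertices.\<close>

inductive grows :: "'a rel \<Rightarrow> 'a set \<Rightarrow> 'a set \<Rightarrow> bool" for R C where
  base: "grows R C C"
| step: "grows R C W \<Longrightarrow> x \<notin> W \<Longrightarrow> {z \<in> W. (x, z) \<in> R} = {y} \<Longrightarrow> grows R C (insert x W)"

lemma grows_superset: "grows R C W \<Longrightarrow> C \<subseteq> W"
  by (induction rule: grows.induct) auto

lemma grows_finite: "grows R C W \<Longrightarrow> finite C \<Longrightarrow> finite W"
  by (induction rule: grows.induct) auto

lemma grows_card_le: "grows R C W \<Longrightarrow> finite C \<Longrightarrow> card C \<le> card W"
  by (meson card_mono grows_finite grows_superset)

text \<open>Each attached vertex only has to avoid the color of its one neighbour among the earlier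
  vertices, which contributes a factor \<open>card A - 1\<close>.\<close>

lemma card_colorings_grows:
  assumes "grows R C W" "sym R" "irrefl R" "finite C" "finite A"
  shows "card (colorings R W A) = card (colorings R C A) * (card A - 1) ^ (card W - card C)"
  using assms(1)
proof (induction rule: grows.induct)
  case (step W x y)
  have "(x, x) \<notin> R" using assms(3) by (auto simp: irrefl_def)
  note ins = card_colorings_insert_pendant[OF assms(2) this step.hyps(2)
      grows_finite[OF step.hyps(1) assms(4)] assms(5) step.hyps(3)]
  have "card (insert x W) - card C = Suc (card W - card C)"
    using step.hyps grows_finite[OF step.hyps(1) assms(4)] grows_card_le[OF step.hyps(1) assms(4)]
    by simp
  then show ?case using ins step.IH by simp
qed simp

text \<open>Induction along the growth; \<open>path\<close> and \<open>cyc\<close> are the facts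
  about the base graph that it starts from. Divisibility by \<open>card A\<close> is carried along
  for every \<open>v\<close>, because attaching a vertex to \<open>v\<close> itself adds one more
  factor \<open>card A\<close> and so upgrades it to divisibility by the square.\<close>

lemma grows_colorings_delete:
  assumes "grows R C W" "sym R" "irrefl R" "finite C" "finite A" "2 \<le> card C"
    and path: "\<And>v. v \<in> C \<Longrightarrow>
      card (colorings R (C - {v}) A) = card A * (card A - 1) ^ (card C - 2)"
    and cyc: "(card A)\<^sup>2 dvd card (colorings R C A)"
    and "v \<in> W"
  shows "card A dvd card (colorings R (W - {v}) A) \<and>
    (if v \<in> C \<and> (\<forall>u\<in>W - C. (v, u) \<notin> R)
     then card (colorings R (W - {v}) A) = card A * (card A - 1) ^ (card W - 2)
     else (card A)\<^sup>2 dvd card (colorings R (W - {v}) A))"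
  using assms(1) \<open>v \<in> W\<close>
proof (induction rule: grows.induct)
  case base
  then show ?case using path by auto
next
  case (step W x y)
  have irr: "(x, x) \<notin> R" using assms(3) by (auto simp: irrefl_def)
  have fin: "finite W" using grows_finite[OF step.hyps(1) assms(4)] .
  have sub: "C \<subseteq> W" using grows_superset[OF step.hyps(1)] .
  have W2: "2 \<le> card W" using assms(6) grows_card_le[OF step.hyps(1) assms(4)] by simp
  have xC: "x \<notin> C" using sub step.hyps by auto
  consider "v = x" | "v = y" "v \<in> W" | "v \<in> W" "v \<noteq> y" using step.prems by auto
  then show ?case
  proof cases
    case 1
    \<comment> \<open>The deleted vertex is the new one: what remains still contains the whole base,
      whose count is divisible by the square.\<close>
    have "(card A)\<^sup>2 dvd card (colorings R W A)"
      using card_colorings_grows[OF step.hyps(1) assms(2-5)] cyc by simp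
    moreover have "insert x W - {v} = W" using 1 step.hyps(2) by auto
    moreover have "card A dvd card (colorings R W A)"
      using calculation by (metis dvd_trans dvd_triv_left power2_eq_square)
    ultimately show ?thesis using 1 xC by auto
  next
    case 2
    \<comment> \<open>The new vertex loses its only neighbour and becomes isolated, and
      \<open>v\<close> now has a neighbour outside \<open>C\<close>, so the second branch of the
      claim applies.\<close>
    have eq: "insert x W - {v} = insert x (W - {v})" using 2 step.hyps(2) by auto
    have "card (colorings R (insert x (W - {v})) A) = card A * card (colorings R (W - {v}) A)"
      using step.hyps 2 fin irr by (intro card_colorings_insert_isolated assms) auto
    moreover have "(v, x) \<in> R" using 2 step.hyps(3) assms(2) by (auto dest: symD)
    ultimately show ?thesis
      using step.IH[OF 2(2)] xC eq by (auto simp: power2_eq_square mult_dvd_mono)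
  next
    case 3
    \<comment> \<open>The new vertex stays pendant: the factor \<open>card A - 1\<close> matches the
      growth of the exponent, and the condition on \<open>v\<close> is unaffected.\<close>
    have eq: "insert x W - {v} = insert x (W - {v})" using 3 step.hyps(2) by auto
    have "card (colorings R (insert x (W - {v})) A) = (card A - 1) * card (colorings R (W - {v}) A)"
      using step.hyps 3 fin irr by (intro card_colorings_insert_pendant[where a = y] assms) auto
    moreover have "(v, x) \<notin> R" using 3 step.hyps(3) assms(2) by (auto dest: symD)
    moreover have "(\<forall>u\<in>insert x W - C. (v, u) \<notin> R) \<longleftrightarrow> (\<forall>u\<in>W - C. (v, u) \<notin> R)"
      using calculation by auto
    moreover have "card (insert x W) - 2 = Suc (card W - 2)"
      using fin step.hyps(2) W2 by simp
    ultimately show ?thesis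
      using step.IH[OF 3(1)] eq by (auto simp: mult.left_commute)
  qed
qed

section \<open>Colorings of paths and cycles\<close>

text \<open>The graph induced on the distinct vertices \<open>f 0, \<dots>, f (c - 1)\<close> is a cycle, in this order.\<close>

definition cycle_enum :: "'a rel \<Rightarrow> nat \<Rightarrow> (nat \<Rightarrow> 'a) \<Rightarrow> bool" where
  "cycle_enum R c f \<longleftrightarrow> 3 \<le> c \<and> inj_on f {..<c} \<and>
     (\<forall>i j. i < j \<and> j < c \<longrightarrow> (f i, f j) \<in> R \<longleftrightarrow> j = Suc i \<or> i = 0 \<and> Suc j = c)"

text \<open>When the cycle is built vertex by vertex, every vertex after the first is pendant on
  arrival, except that the last one closes the cycle.\<close>

lemma cycle_enum_neighbours:
  assumes "cycle_enum R c f" "sym R" "0 < k" "k < c"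
  shows "{y \<in> f ` {..<k}. (f k, y) \<in> R} = (if Suc k = c then {f 0, f (k - 1)} else {f (k - 1)})"
proof -
  have "(f k, f i) \<in> R \<longleftrightarrow> k = Suc i \<or> i = 0 \<and> Suc k = c" if "i < k" for i
  proof -
    have "(f k, f i) \<in> R \<longleftrightarrow> (f i, f k) \<in> R" using assms(2) by (auto dest: symD)
    then show ?thesis using assms(1,4) that by (simp add: cycle_enum_def)
  qed
  then have "{y \<in> f ` {..<k}. (f k, y) \<in> R} = f ` {i. i < k \<and> (k = Suc i \<or> i = 0 \<and> Suc k = c)}"
    by blast
  also have "{i. i < k \<and> (k = Suc i \<or> i = 0 \<and> Suc k = c)} = (if Suc k = c then {0, k - 1} else {k - 1})"
    using assms(3) by auto
  finally show ?thesis by simp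
qed

lemma cycle_enum_notin:
  assumes "cycle_enum R c f" "k < c"
  shows "f k \<notin> f ` {..<k}"
proof
  assume "f k \<in> f ` {..<k}"
  then obtain i where "i < k" "f k = f i" by auto
  moreover have "inj_on f {..<c}" using assms(1) by (simp add: cycle_enum_def)
  ultimately show False using assms(2) inj_onD[of f "{..<c}" k i] by auto
qed

text \<open>The bound on \<open>k\<close> keeps the last cycle vertex out, so every insertion after
  the first is pendant.\<close>

lemma card_colorings_subpath:
  assumes f: "cycle_enum R c f" and R: "sym R" "irrefl R" and A: "finite A"
    and k: "Suc k < c"
  shows "card (colorings R (f ` {..<Suc k}) A) = card A * (card A - 1) ^ k"
  using k
proof (induction k)
  case 0
  have "(f 0, f 0) \<notin> R" using R by (auto simp: irrefl_def)
  moreover have "colorings R {} A = {\<lambda>_. undefined}" by (auto simp: colorings_def)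
  ultimately show ?case
    using card_colorings_insert_isolated[of R "f 0" "{}" A] R A
    by (simp add: lessThan_Suc)
next
  case (Suc k)
  have irr: "(f (Suc k), f (Suc k)) \<notin> R" using R by (auto simp: irrefl_def)
  have "{y \<in> f ` {..<Suc k}. (f (Suc k), y) \<in> R} = {f k}"
    using cycle_enum_neighbours[OF f R(1), of "Suc k"] Suc.prems by simp
  then have "card (colorings R (insert (f (Suc k)) (f ` {..<Suc k})) A)
      = (card A - 1) * card (colorings R (f ` {..<Suc k}) A)"
    using cycle_enum_notin[OF f, of "Suc k"] Suc.prems irr
    by (intro card_colorings_insert_pendant R A) auto
  then show ?case using Suc by (simp add: lessThan_Suc[of "Suc k"])
qed

text \<open>This is deletion-contraction for cycles in disguise: paths whose ends differ in color
  correspond to colorings of a cycle on the same vertices. The counts for \<open>k\<close> and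
  \<open>Suc k\<close> add up to the number of colorings of the longer path; for
  \<open>k = 0\<close> the two ends coincide and both sides are 0.\<close>

lemma card_colorings_path_ends:
  assumes f: "cycle_enum R c f" and R: "sym R" "irrefl R" and A: "finite A" "A \<noteq> {}"
    and k: "Suc k < c"
  defines "t \<equiv> int (card A)"
  shows "int (card {\<kappa> \<in> colorings R (f ` {..<Suc k}) A. \<kappa> (f 0) \<noteq> \<kappa> (f k)})
    = (t - 1) ^ Suc k + (- 1) ^ Suc k * (t - 1)"
  using k
proof (induction k)
  case (Suc k)
  let ?x = "f (Suc k)" and ?U = "f ` {..<Suc k}"
  text \<open>Joining the ends of the path by an edge turns the condition into properness.\<close>
  define R' where "R' = R \<union> {(f 0, ?x), (?x, f 0)}"
  have nin: "?x \<notin> ?U" using cycle_enum_notin[OF f, of "Suc k"] Suc.prems by simp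
  have R'U: "colorings R' ?U A = colorings R ?U A"
  proof (rule colorings_cong)
    fix u v assume "u \<in> ?U" "v \<in> ?U"
    with nin have "u \<noteq> ?x" "v \<noteq> ?x" by metis+
    then show "(u, v) \<in> R' \<longleftrightarrow> (u, v) \<in> R" by (simp add: R'_def)
  qed
  have ne: "f 0 \<noteq> ?x" using nin by (metis imageI lessThan_iff zero_less_Suc)
  have "{y \<in> ?U. (?x, y) \<in> R} = {f k}"
    using cycle_enum_neighbours[OF f R(1), of "Suc k"] Suc.prems by simp
  moreover have "f 0 \<in> ?U" by auto
  ultimately have "{y \<in> ?U. (?x, y) \<in> R'} = {f 0, f k}"
    using ne by (auto simp: R'_def)
  then have "card (colorings R' (insert ?x ?U) A) + card {\<kappa> \<in> colorings R' ?U A. \<kappa> (f 0) \<noteq> \<kappa> (f k)}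
      = (card A - 1) * card (colorings R' ?U A)"
    using R ne nin A
    by (intro card_colorings_insert_two) (auto simp: R'_def sym_def irrefl_def)
  moreover have "colorings R' (insert ?x ?U) A
      = {\<kappa> \<in> colorings R (insert ?x ?U) A. \<kappa> (f 0) \<noteq> \<kappa> ?x}"
    by (auto simp: colorings_def R'_def)
  moreover have "insert ?x ?U = f ` {..<Suc (Suc k)}"
    by (simp add: lessThan_Suc[of "Suc k"])
  ultimately have "card {\<kappa> \<in> colorings R (f ` {..<Suc (Suc k)}) A. \<kappa> (f 0) \<noteq> \<kappa> ?x}
      + card {\<kappa> \<in> colorings R ?U A. \<kappa> (f 0) \<noteq> \<kappa> (f k)} = (card A - 1) * (card A * (card A - 1) ^ k)"
    using card_colorings_subpath[OF f R A(1), of k] Suc.prems R'U by simp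
  then have "int (card {\<kappa> \<in> colorings R (f ` {..<Suc (Suc k)}) A. \<kappa> (f 0) \<noteq> \<kappa> ?x})
      + int (card {\<kappa> \<in> colorings R ?U A. \<kappa> (f 0) \<noteq> \<kappa> (f k)}) = int ((card A - 1) * (card A * (card A - 1) ^ k))"
    unfolding of_nat_add[symmetric] by (rule arg_cong)
  \<comment> \<open>Since \<open>A\<close> is nonempty, the subtraction is not truncated.\<close>
  moreover have "int (card A - 1) = t - 1"
    using A by (simp add: t_def of_nat_diff card_gt_0_iff Suc_leI)
  ultimately have "int (card {\<kappa> \<in> colorings R (f ` {..<Suc (Suc k)}) A. \<kappa> (f 0) \<noteq> \<kappa> ?x})
      = (t - 1) * (t * (t - 1) ^ k) - ((t - 1) ^ Suc k + (- 1) ^ Suc k * (t - 1))"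
    using Suc.IH Suc.prems by (simp add: t_def)
  also have "\<dots> = (t - 1) ^ Suc (Suc k) + (- 1) ^ Suc (Suc k) * (t - 1)"
    by (simp add: algebra_simps)
  finally show ?case .
qed simp

text \<open>The last vertex is joined to both ends of the path on the other vertices, so the
  colorings of that path with differing ends account for the correction term.\<close>

lemma card_colorings_cycle:
  assumes f: "cycle_enum R c f" and R: "sym R" "irrefl R" and A: "finite A" "A \<noteq> {}"
  defines "t \<equiv> int (card A)"
  shows "int (card (colorings R (f ` {..<c}) A)) = (t - 1) ^ c + (- 1) ^ c * (t - 1)"
proof -
  define k where "k = c - 2"
  have c: "c = Suc (Suc k)"
    using f by (auto simp: cycle_enum_def k_def)
  let ?x = "f (Suc k)" and ?U = "f ` {..<Suc k}"
  have nin: "?x \<notin> ?U" using cycle_enum_notin[OF f, of "Suc k"] c by simp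
  have "{y \<in> ?U. (?x, y) \<in> R} = {f 0, f k}"
    using cycle_enum_neighbours[OF f R(1), of "Suc k"] c by simp
  then have "card (colorings R (insert ?x ?U) A) + card {\<kappa> \<in> colorings R ?U A. \<kappa> (f 0) \<noteq> \<kappa> (f k)}
      = (card A - 1) * card (colorings R ?U A)"
    using R nin A
    by (intro card_colorings_insert_two) (auto simp: irrefl_def)
  moreover have "insert ?x ?U = f ` {..<c}"
    by (simp add: c lessThan_Suc[of "Suc k"])
  ultimately have "card (colorings R (f ` {..<c}) A)
      + card {\<kappa> \<in> colorings R ?U A. \<kappa> (f 0) \<noteq> \<kappa> (f k)} = (card A - 1) * (card A * (card A - 1) ^ k)"
    using card_colorings_subpath[OF f R A(1), of k] c by simp
  then have "int (card (colorings R (f ` {..<c}) A))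
      + int (card {\<kappa> \<in> colorings R ?U A. \<kappa> (f 0) \<noteq> \<kappa> (f k)}) = int ((card A - 1) * (card A * (card A - 1) ^ k))"
    unfolding of_nat_add[symmetric] by (rule arg_cong)
  moreover have "int (card A - 1) = t - 1"
    using A by (simp add: t_def of_nat_diff card_gt_0_iff Suc_leI)
  ultimately have "int (card (colorings R (f ` {..<c}) A))
      = (t - 1) * (t * (t - 1) ^ k) - ((t - 1) ^ Suc k + (- 1) ^ Suc k * (t - 1))"
    using card_colorings_path_ends[OF f R A, of k] c by (simp add: t_def)
  also have "\<dots> = (t - 1) ^ c + (- 1) ^ c * (t - 1)"
    by (simp add: c algebra_simps)
  finally show ?thesis .
qed

text \<open>These are the constant and linear terms of the binomial expansion; all others contain
  the square of \<open>x\<close>.\<close>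

lemma square_dvd_power_minus_one:
  fixes x :: int
  shows "x\<^sup>2 dvd (x - 1) ^ k - (- 1) ^ k * (1 - int k * x)"
proof (induction k)
  case (Suc k)
  have "(x - 1) ^ Suc k - (- 1) ^ Suc k * (1 - int (Suc k) * x)
      = (x - 1) * ((x - 1) ^ k - (- 1) ^ k * (1 - int k * x)) - (- 1) ^ k * int k * x\<^sup>2"
    by (simp add: algebra_simps power2_eq_square)
  moreover have "x\<^sup>2 dvd (x - 1) * ((x - 1) ^ k - (- 1) ^ k * (1 - int k * x))"
    using Suc by (rule dvd_mult)
  ultimately show ?case by (simp only: dvd_diff dvd_triv_right)
qed simp

text \<open>Modulo the square of \<open>t = card A\<close>, the cycle count is
  \<open>(- 1) ^ c * (1 - c * t + t - 1)\<close>, that is, \<open>(- 1) ^ c * t * (1 - c)\<close>.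
  Here \<open>1 - c\<close> equals \<open>- t\<close>, which supplies the second factor.\<close>

lemma square_dvd_card_colorings_cycle:
  assumes f: "cycle_enum R c f" and R: "sym R" "irrefl R" and A: "finite A" "Suc (card A) = c"
  shows "(card A)\<^sup>2 dvd card (colorings R (f ` {..<c}) A)"
proof -
  let ?t = "int (card A)"
  have c: "3 \<le> c" using f by (simp add: cycle_enum_def)
  have ne: "A \<noteq> {}" using A c by auto
  have "int (card (colorings R (f ` {..<c}) A))
      = ((?t - 1) ^ c - (- 1) ^ c * (1 - int c * ?t)) - (- 1) ^ c * ?t\<^sup>2"
  proof -
    have "int c = ?t + 1" using A(2) by simp
    then show ?thesis
      unfolding card_colorings_cycle[OF f R A(1) ne] by (simp only:) (simp add: algebra_simps power2_eq_square)
  qed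
  also have "?t\<^sup>2 dvd \<dots>"
    by (intro dvd_diff square_dvd_power_minus_one dvd_triv_right)
  finally show ?thesis by (metis of_nat_power int_dvd_int_iff)
qed

section \<open>Connected unicyclic graphs\<close>

lemma pcas_nth:
  assumes "pcas u p v"
  shows "Suc i < length p \<Longrightarrow> snd (p ! i) = fst (p ! Suc i)"
    and "p \<noteq> [] \<Longrightarrow> fst (p ! 0) = u \<and> snd (last p) = v"
proof -
  show "snd (p ! i) = fst (p ! Suc i)" if "Suc i < length p"
    using assms that
  proof (induction p arbitrary: u i)
    case (Cons e p)
    show ?case
    proof (cases i)
      case 0
      then show ?thesis using Cons.prems by (cases p) auto
    next
      case (Suc j)
      then show ?thesis using Cons.IH[of "snd e" j] Cons.prems by simp
    qed
  qed simp
  show "fst (p ! 0) = u \<and> snd (last p) = v" if "p \<noteq> []"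
    using assms that
  proof (induction p arbitrary: u)
    case (Cons e p)
    then show ?case by (cases p) auto
  qed simp
qed

text \<open>The start vertices of the arcs are continued with period \<open>c\<close>. The closing
  arc then looks like every other arc, and starting the cycle elsewhere is a shift of the
  index.\<close>

lemma cycle_in_enum:
  assumes "cycle_in G C"
  obtains c f where "3 \<le> c" "inj_on f {..<c}" "\<And>i. f (i + c) = f i" "pverts C = f ` {..<c}"
    "parcs C = range (\<lambda>i. (f i, f (Suc i))) \<union> (range (\<lambda>i. (f i, f (Suc i))))\<inverse>"
proof -
  interpret pair_pre_digraph G .
  obtain p where p: "cycle p" "3 \<le> length p"
      and C: "C = \<lparr>pverts = fst ` set p, parcs = set p \<union> (set p)\<inverse>\<rparr>"
    using assms by (auto simp: cycle_in_def)
  obtain u where u: "awalk u p u" "distinct (tl (pawalk_verts u p))"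
    using p(1) by (auto simp: cycle_def)
  define c where "c = length p"
  define f where "f i = fst (p ! (i mod c))" for i
  have pc: "pcas u p u" using u(1) by (simp add: awalk_def)
  have ne: "p \<noteq> []" "0 < c" using p(2) by (auto simp: c_def)
  have snd_p: "snd (p ! i) = f (Suc i)" if "i < c" for i
  proof (cases "Suc i < c")
    case True
    then show ?thesis using pcas_nth(1)[OF pc, of i] by (simp add: f_def c_def)
  next
    case False
    \<comment> \<open>The last arc ends at \<open>u\<close>, the start of the first arc, so the
      enumeration wraps around.\<close>
    then have "Suc i = c" using that by simp
    then have "p ! i = last p" using ne by (metis c_def diff_Suc_1 last_conv_nth)
    then show ?thesis using pcas_nth(2)[OF pc ne(1)] \<open>Suc i = c\<close> by (simp add: f_def)
  qed
  have "tl (pawalk_verts u p) = map snd p"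
    using awalk_verts_conv'[of u p u] pc ne by simp
  then have dist: "distinct (map snd p)" using u(2) by simp
  have "inj_on f {..<c}"
  proof (rule inj_onI)
    fix i j assume ij: "i \<in> {..<c}" "j \<in> {..<c}" "f i = f j"
    \<comment> \<open>\<open>pr\<close> is the cyclic predecessor: distinctness is known for the end
      points of the arcs, and \<open>f k\<close> is the end point of arc
      \<open>pr k\<close>.\<close>
    define pr where "pr k = (if k = 0 then c - 1 else k - 1)" for k
    have pr: "pr k < c" "f (Suc (pr k)) = f k" if "k < c" for k
      using that ne(2) by (auto simp: pr_def f_def)
    have "snd (p ! pr i) = snd (p ! pr j)"
      using snd_p[of "pr i"] snd_p[of "pr j"] pr[of i] pr[of j] ij by simp
    then have "pr i = pr j"
      using dist pr[of i] pr[of j] ij by (simp add: distinct_conv_nth c_def) metis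
    then show "i = j" using ij by (auto simp: pr_def split: if_splits)
  qed
  moreover have "f (i + c) = f i" for i by (simp add: f_def)
  moreover have "fst ` set p = f ` {..<c}"
  proof -
    have "set p = (!) p ` {..<c}" by (auto simp: set_conv_nth c_def)
    then show ?thesis by (auto simp: f_def image_image)
  qed
  moreover have "set p = range (\<lambda>i. (f i, f (Suc i)))"
  proof -
    have *: "p ! i = (f i, f (Suc i))" if "i < c" for i
      using snd_p[OF that] that by (metis f_def mod_less prod.collapse)
    have "(f i, f (Suc i)) = p ! (i mod c)" for i
    proof -
      have "f (Suc (i mod c)) = f (Suc i)" by (simp add: f_def mod_Suc_eq)
      moreover have "f (i mod c) = f i" by (simp add: f_def)
      ultimately show ?thesis using *[of "i mod c"] ne(2) by simp
    qed
    then have "range (\<lambda>i. (f i, f (Suc i))) = (\<lambda>i. p ! (i mod c)) ` UNIV" by simp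
    also have "\<dots> = (!) p ` {..<c}"
    proof -
      have "(\<lambda>i::nat. i mod c) ` UNIV = {..<c}"
        using ne(2) by (auto simp: image_iff) (metis mod_less)
      then show ?thesis by (metis image_image)
    qed
    also have "\<dots> = set p" by (auto simp: set_conv_nth c_def)
    finally show ?thesis by simp
  qed
  ultimately show ?thesis
    using that[of c f] p(2) by (simp add: C c_def)
qed

section \<open>Consequences of having a unique cycle\<close>

lemma sym_parcs: "pair_graph G \<Longrightarrow> sym (parcs G)"
proof -
  assume "pair_graph G"
  then interpret pair_graph G .
  show ?thesis using arcs_symmetric by (auto simp: sym_def)
qed

lemma irrefl_parcs: "pair_graph G \<Longrightarrow> irrefl (parcs G)"
proof -
  assume "pair_graph G"
  then interpret pair_graph G .
  show ?thesis using no_loops' by (auto simp: irrefl_def)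
qed

lemma the_cycle_eqI:
  assumes "unicyclic G" "cycle_in G C"
  shows "the_cycle G = C"
  unfolding the_cycle_def using assms(1)[unfolded unicyclic_def] assms(2) by (rule the1_equality)

lemma cycle_in_parcs_subset:
  assumes "pair_graph G" "cycle_in G C"
  shows "parcs C \<subseteq> parcs G"
proof -
  interpret pair_graph G by fact
  obtain p u where "awalk u p u" and C: "C = \<lparr>pverts = fst ` set p, parcs = set p \<union> (set p)\<inverse>\<rparr>"
    using assms(2) by (auto simp: cycle_in_def cycle_def)
  then have "set p \<subseteq> parcs G" by (simp add: awalk_def)
  then show ?thesis using C arcs_symmetric by auto
qed

text \<open>A simple path from \<open>b\<close> to \<open>a\<close> inside \<open>R\<close>, closed
  by the arc \<open>(a, b)\<close>, is a cycle and hence the only one. Excluding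
  \<open>(b, a)\<close> from \<open>R\<close> rules out the path with a single arc, so the closed
  walk has length at least 3.\<close>

lemma arc_on_the_cycle:
  assumes G: "pair_graph G" "unicyclic G"
    and ab: "(a, b) \<in> parcs G" and R: "R \<subseteq> parcs G" "(b, a) \<in> R\<^sup>*" "(b, a) \<notin> R"
  shows "(a, b) \<in> parcs (the_cycle G)"
proof -
  interpret pair_graph G by fact
  \<comment> \<open>With the arcs cut down to \<open>R\<close>, the simple path extracted from
    reachability stays in \<open>R\<close>.\<close>
  let ?H = "\<lparr>pverts = pverts G, parcs = R\<rparr>"
  interpret H: pair_wf_digraph ?H
  proof
    fix e assume "e \<in> parcs ?H"
    then have "e \<in> parcs G" using R(1) by auto
    then show "fst e \<in> pverts ?H" "snd e \<in> pverts ?H"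
      using arc_fst_in_verts arc_snd_in_verts by simp_all
  qed
  have ends: "b \<in> pverts G" "a \<in> pverts G" "a \<noteq> b"
    using ab in_arcsD1 in_arcsD2 no_loops' by auto
  have "b \<rightarrow>\<^sup>*\<^bsub>with_proj ?H\<^esub> a"
    using R(2) ends by (simp add: H.reachable_conv)
  then obtain p where p: "H.apath b p a" using H.reachable_apath by blast
  have pR: "set p \<subseteq> R" "pcas b p a" "distinct (pawalk_verts b p)"
    using p by (auto simp: H.apath_def H.awalk_def)
  have "p \<noteq> []" using pR(2) ends by auto
  then obtain e p' where p': "p = e # p'" by (cases p) auto
  moreover have "p' \<noteq> []" using pR(1,2) R(3) p' by (cases e) auto
  ultimately have len: "2 \<le> length p" by (cases p') auto
  let ?q = "(a, b) # p"
  have "awalk a ?q a"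
    using pR R(1) ab ends by (auto simp: awalk_def)
  moreover have "distinct (tl (pawalk_verts a ?q))" using pR(3) by simp
  ultimately have "cycle ?q" by (auto simp: cycle_def)
  then have "cycle_in G \<lparr>pverts = fst ` set ?q, parcs = set ?q \<union> (set ?q)\<inverse>\<rparr>"
    using len unfolding cycle_in_def by (intro exI[of _ ?q]) auto
  then have "the_cycle G = \<lparr>pverts = fst ` set ?q, parcs = set ?q \<union> (set ?q)\<inverse>\<rparr>"
    by (rule the_cycle_eqI[OF G(2)])
  then show ?thesis by simp
qed

section \<open>Reachability and growing the graph from its cycle\<close>

lemma rtrancl_range_Suc:
  assumes "range (\<lambda>i. (f i, f (Suc i))) \<subseteq> R" "sym R"
  shows "(f i, f j) \<in> R\<^sup>*"
proof -
  have up: "(f i, f (i + k)) \<in> R\<^sup>*" for i k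
  proof (induction k)
    case (Suc k)
    have "(f (i + k), f (i + Suc k)) \<in> R" using assms(1) by auto
    with Suc show ?case by (rule rtrancl.rtrancl_into_rtrancl)
  qed simp
  show ?thesis
  proof (cases "i \<le> j")
    case True
    then show ?thesis using up[of i "j - i"] by simp
  next
    case False
    then have "(f j, f i) \<in> R\<^sup>*" using up[of j "i - j"] by simp
    then show ?thesis using assms(2) by (metis sym_rtrancl symD)
  qed
qed

text \<open>Reachability is claimed inside \<open>W\<close>, so that the paths obtained avoid every
  vertex outside \<open>W\<close>.\<close>

lemma grows_reachable:
  assumes "grows R C W" "sym R"
    and base: "\<And>a b. a \<in> C \<Longrightarrow> b \<in> C \<Longrightarrow> (a, b) \<in> (R \<inter> C \<times> C)\<^sup>*"
    and "a \<in> W" "b \<in> W"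
  shows "(a, b) \<in> (R \<inter> W \<times> W)\<^sup>*"
  using assms(1) \<open>a \<in> W\<close> \<open>b \<in> W\<close>
proof (induction arbitrary: a b rule: grows.induct)
  case base
  then show ?case by (rule assms(3))
next
  case (step W x y)
  let ?R = "R \<inter> insert x W \<times> insert x W"
  have W: "(a, b) \<in> ?R\<^sup>*" if "a \<in> W" "b \<in> W" for a b
    using step.IH[OF that] by (rule rtrancl_mono[THEN subsetD, rotated]) auto
  have xy: "(x, y) \<in> ?R" "(y, x) \<in> ?R" "y \<in> W"
    using step.hyps(3) assms(2) by (auto dest: symD)
  have "(a, y) \<in> ?R\<^sup>*" using step.prems(1) W[of a y] xy by auto
  moreover have "(y, b) \<in> ?R\<^sup>*" using step.prems(2) W[of y b] xy by auto
  ultimately show ?case by (rule rtrancl_trans)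
qed

lemma connected_rtrancl:
  assumes "pair_graph G" "connected (with_proj G)" "u \<in> pverts G" "v \<in> pverts G"
  shows "(u, v) \<in> (parcs G)\<^sup>*"
proof -
  interpret pair_graph G by fact
  have "strongly_connected (with_proj G)"
    using assms(2) sym_arcs by (intro symmetric_connected_imp_strongly_connected)
  then have "u \<rightarrow>\<^sup>*\<^bsub>with_proj G\<^esub> v"
    using assms(3,4) by (auto simp: strongly_connected_def)
  then show ?thesis by (simp add: reachable_conv)
qed

lemma rtrancl_leaves:
  assumes "(u, v) \<in> R\<^sup>*" "u \<in> W" "v \<notin> W"
  obtains x y where "x \<in> W" "y \<notin> W" "(x, y) \<in> R"
proof -
  have "\<exists>x y. x \<in> W \<and> y \<notin> W \<and> (x, y) \<in> R"
    using assms
  proof (induction rule: rtrancl_induct)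
    case (step y z)
    then show ?case by (cases "y \<in> W") auto
  qed simp
  then show ?thesis using that by blast
qed

text \<open>As long as vertices are missing, connectedness yields an edge from the part built so far
  to a new vertex \<open>x\<close>. A second neighbour of \<open>x\<close> in that part would put
  \<open>x\<close> on the unique cycle, which lies inside \<open>C\<close>.\<close>

lemma unicyclic_grows:
  assumes G: "pair_graph G" "connected (with_proj G)" "unicyclic G"
    and C: "C \<subseteq> pverts G" "C \<noteq> {}" "parcs (the_cycle G) \<subseteq> C \<times> C"
      "\<And>a b. a \<in> C \<Longrightarrow> b \<in> C \<Longrightarrow> (a, b) \<in> (parcs G \<inter> C \<times> C)\<^sup>*"
  shows "grows (parcs G) C (pverts G)"
proof -
  interpret pair_graph G by fact
  have sym: "sym (parcs G)" using sym_parcs G(1) .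
  \<comment> \<open>Induction on the number \<open>k\<close> of attached vertices; the largest
    possible \<open>k\<close> exhausts the graph.\<close>
  have ex: "\<exists>W'. grows (parcs G) C W' \<and> W' \<subseteq> pverts G \<and> card W' = card C + k"
    if "card C + k \<le> card (pverts G)" for k
    using that
  proof (induction k)
    case 0
    then show ?case using grows.base C(1) by auto
  next
    case (Suc k)
    then obtain W where W: "grows (parcs G) C W" "W \<subseteq> pverts G" "card W = card C + k" by auto
    have CW: "C \<subseteq> W" using grows_superset[OF W(1)] .
    have "W \<noteq> pverts G" using W(3) Suc.prems by auto
    then obtain v where v: "v \<in> pverts G" "v \<notin> W" using W(2) by auto
    obtain u where u: "u \<in> C" using C(2) by auto
    have "(u, v) \<in> (parcs G)\<^sup>*" using connected_rtrancl[OF G(1,2)] u v C(1) by auto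
    moreover have "u \<in> W" using u CW by auto
    ultimately obtain y x where yx: "y \<in> W" "x \<notin> W" "(y, x) \<in> parcs G"
      using v(2) by (rule rtrancl_leaves)
    have "z = y" if z: "z \<in> W" "(x, z) \<in> parcs G" for z
    proof (rule ccontr)
      assume "z \<noteq> y"
      \<comment> \<open>A path from \<open>z\<close> to \<open>y\<close> inside \<open>W\<close> is
        continued by the arc to \<open>x\<close>. The arc \<open>(z, x)\<close> itself is not in
        \<open>?R\<close>, since \<open>z \<noteq> y\<close> and \<open>x\<close> is outside
        \<open>W\<close>.\<close>
      let ?R = "insert (y, x) (parcs G \<inter> W \<times> W)"
      have "(z, y) \<in> (parcs G \<inter> W \<times> W)\<^sup>*"
        using grows_reachable[OF W(1) sym C(4)] z(1) yx(1) by blast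
      then have "(z, y) \<in> ?R\<^sup>*" by (rule rtrancl_mono[THEN subsetD, rotated]) auto
      then have "(z, x) \<in> ?R\<^sup>*" by (rule rtrancl.rtrancl_into_rtrancl) simp
      then have "(x, z) \<in> parcs (the_cycle G)"
        using yx z \<open>z \<noteq> y\<close> by (intro arc_on_the_cycle[OF G(1,3)]) auto
      then show False using C(3) CW yx(2) by auto
    qed
    then have "{z \<in> W. (x, z) \<in> parcs G} = {y}" using yx(1) arcs_symmetric[OF yx(3)] by blast
    with W(1) yx(2) have "grows (parcs G) C (insert x W)" by (rule grows.step)
    moreover have "insert x W \<subseteq> pverts G" using W(2) yx(3) in_arcsD2 by auto
    moreover have "card (insert x W) = card C + Suc k"
      using W yx(2) finite_subset[OF W(2) pair_finite_verts] by simp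
    ultimately show ?case by blast
  qed
  have le: "card C \<le> card (pverts G)" using pair_finite_verts C(1) by (rule card_mono)
  obtain W where W: "grows (parcs G) C W" "W \<subseteq> pverts G"
      "card W = card C + (card (pverts G) - card C)"
    using ex[of "card (pverts G) - card C"] le by auto
  then have "W = pverts G" using le pair_finite_verts by (intro card_subset_eq) auto
  then show ?thesis using W(1) by simp
qed

section \<open>The cycle as an induced subgraph\<close>

text \<open>Collects what the counting needs. The shifts by \<open>s\<close> allow any chosen cycle
  vertex to come last in the enumeration.\<close>

lemma unicyclic_structure:
  assumes G: "pair_graph G" "connected (with_proj G)" "unicyclic G"
  defines "C \<equiv> pverts (the_cycle G)" and "E \<equiv> parcs G"
  obtains f where "C = f ` {..<cycle_size G}" "\<And>i. f (i + cycle_size G) = f i"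
    "\<And>s. cycle_enum E (cycle_size G) (\<lambda>i. f (i + s))"
    "\<And>s. C = (\<lambda>i. f (i + s)) ` {..<cycle_size G}"
    "grows E C (pverts G)"
    "E \<inter> C \<times> C = parcs (the_cycle G)"
proof -
  interpret pair_graph G by fact
  have cyc: "cycle_in G (the_cycle G)"
    using G(3) unfolding unicyclic_def the_cycle_def by (rule theI')
  obtain c f where f: "3 \<le> c" "inj_on f {..<c}" "\<And>i. f (i + c) = f i" "C = f ` {..<c}"
      "parcs (the_cycle G) = range (\<lambda>i. (f i, f (Suc i))) \<union> (range (\<lambda>i. (f i, f (Suc i))))\<inverse>"
    by (rule cycle_in_enum[OF cyc, folded C_def]) (rule that)
  have c: "cycle_size G = c"
    unfolding cycle_size_def C_def[symmetric] f(4) using f(2) by (simp add: card_image)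
  have f_mult: "f (i + k * c) = f i" for i k
  proof (induction k)
    case (Suc k)
    then show ?case using f(3)[of "i + k * c"] by (simp add: ac_simps)
  qed simp
  have f_mod: "f i = f (i mod c)" for i
    using f_mult[of "i mod c" "i div c"] by simp
  have f_eq: "f i = f j \<longleftrightarrow> i mod c = j mod c" for i j
  proof -
    have "i mod c < c" "j mod c < c" using f(1) by auto
    then show ?thesis
      using inj_on_eq_iff[OF f(2), of "i mod c" "j mod c"] f_mod[of i] f_mod[of j] by simp
  qed
  have fC: "f i \<in> C" for i
  proof -
    have "i mod c < c" using f(1) by simp
    then have "f (i mod c) \<in> C" unfolding f(4) by simp
    then show ?thesis using f_mod[of i] by simp
  qed
  have sub: "parcs (the_cycle G) \<subseteq> E" using cycle_in_parcs_subset[OF G(1) cyc] by (simp add: E_def)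
  have subC: "parcs (the_cycle G) \<subseteq> C \<times> C" unfolding f(5) using fC by auto
  have symC: "sym (parcs (the_cycle G))" unfolding f(5) by (auto simp: sym_def)
  have conn: "(a, b) \<in> (parcs (the_cycle G))\<^sup>*" if ab: "a \<in> C" "b \<in> C" for a b
  proof -
    obtain i j where "a = f i" "b = f j" using ab unfolding f(4) by auto
    then show ?thesis using rtrancl_range_Suc[OF _ symC, of f i j] f(5) by simp
  qed
  \<comment> \<open>A chord and a path along the cycle between its ends would close a cycle, so by
    uniqueness the chord would already be a cycle edge.\<close>
  have nochord: "E \<inter> C \<times> C = parcs (the_cycle G)"
  proof
    show "E \<inter> C \<times> C \<subseteq> parcs (the_cycle G)"
    proof (rule subrelI, rule ccontr)
      fix a b assume ab: "(a, b) \<in> E \<inter> C \<times> C" "(a, b) \<notin> parcs (the_cycle G)"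
      then have "(b, a) \<notin> parcs (the_cycle G)" using symC by (auto dest: symD)
      then show False
        using ab arc_on_the_cycle[OF G(1,3), of a b "parcs (the_cycle G)"] sub conn[of b a]
        by (auto simp: E_def)
    qed
  qed (use sub subC in auto)
  have "C \<subseteq> pverts G"
  proof
    fix v assume "v \<in> C"
    then obtain i where "v = f i" by (auto simp: f(4))
    then have "(v, f (Suc i)) \<in> E" using sub f(5) by auto
    then show "v \<in> pverts G" by (auto simp: E_def dest: in_arcsD1)
  qed
  moreover have "C \<noteq> {}" using fC by auto
  moreover have "(a, b) \<in> (parcs G \<inter> C \<times> C)\<^sup>*" if "a \<in> C" "b \<in> C" for a b
    using conn[OF that] nochord by (simp add: E_def)
  ultimately have grows: "grows E C (pverts G)"
    unfolding E_def using subC by (intro unicyclic_grows G)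
  have enum: "cycle_enum E c (\<lambda>i. f (i + s))" for s
  proof -
    have mod_ne: "(i + s) mod c \<noteq> (j + s) mod c" if "i < j" "j < i + c" for i j
    proof
      assume "(i + s) mod c = (j + s) mod c"
      then have "c dvd (j + s) - (i + s)" 
        using that mod_eq_dvd_iff_nat[of "i + s" "j + s" c] by simp
      then have "c dvd j - i" by simp
      then show False using that by (auto dest!: dvd_imp_le)
    qed
    have "inj_on (\<lambda>i. f (i + s)) {..<c}"
    proof (rule inj_onI, rule ccontr)
      fix i j assume "i \<in> {..<c}" "j \<in> {..<c}" "f (i + s) = f (j + s)" "i \<noteq> j"
      then show False
        using mod_ne[of i j] mod_ne[of j i] f_eq[of "i + s" "j + s"] by (cases "i < j") auto
    qed
    moreover have "(f (i + s), f (j + s)) \<in> E \<longleftrightarrow> j = Suc i \<or> i = 0 \<and> Suc j = c"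
      if ij: "i < j" "j < c" for i j
    proof -
      \<comment> \<open>This turns adjacency into equations between indices in a window of length
        \<open>c\<close>; only the successor of the last index leaves the window.\<close>
      have eqs: "f k = f l \<longleftrightarrow> k = l" if "s \<le> k" "s \<le> l" "k < s + c" "l < s + c" for k l
      proof (cases k l rule: linorder_cases)
        case less
        then have "k - s < l - s" "l - s < (k - s) + c" using that by arith+
        from mod_ne[OF this] show ?thesis using less that f_eq[of k l] by auto
      next
        case greater
        then have "l - s < k - s" "k - s < (l - s) + c" using that by arith+
        from mod_ne[OF this] show ?thesis using greater that f_eq[of k l] by auto
      qed simp
      have adj: "(f (i + s), f (j + s)) \<in> E \<longleftrightarrow>
          f (Suc (i + s)) = f (j + s) \<or> f (Suc (j + s)) = f (i + s)"
      proof -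
        have "(f (i + s), f (j + s)) \<in> E \<longleftrightarrow> (f (i + s), f (j + s)) \<in> parcs (the_cycle G)"
          unfolding nochord[symmetric] using fC by simp
        also have "\<dots> \<longleftrightarrow> (\<exists>k. f (i + s) = f k \<and> f (j + s) = f (Suc k)) \<or>
            (\<exists>k. f (j + s) = f k \<and> f (i + s) = f (Suc k))"
          unfolding f(5) by auto
        also have "\<dots> \<longleftrightarrow> f (Suc (i + s)) = f (j + s) \<or> f (Suc (j + s)) = f (i + s)"
        proof -
          have step: "f (Suc k) = f (Suc l)" if "f k = f l" for k l
            using that unfolding f_eq by (metis mod_Suc_eq)
          have "(\<exists>k. f a = f k \<and> f b = f (Suc k)) \<longleftrightarrow> f (Suc a) = f b" for a b
            by (auto dest: step)
          then show ?thesis by simp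
        qed
        finally show ?thesis .
      qed
      have "f (Suc (i + s)) = f (j + s) \<longleftrightarrow> j = Suc i"
        using eqs[of "Suc (i + s)" "j + s"] ij by auto
      moreover have "f (Suc (j + s)) = f (i + s) \<longleftrightarrow> i = 0 \<and> Suc j = c"
      proof (cases "Suc j = c")
        case True
        \<comment> \<open>The index outside the window wraps around to \<open>f s\<close>, which
          accounts for the closing edge.\<close>
        then have "Suc (j + s) = s + c" by simp
        then have "f (Suc (j + s)) = f s" by (simp only: f(3))
        then show ?thesis using eqs[of s "i + s"] ij True by auto
      next
        case False
        then show ?thesis using eqs[of "Suc (j + s)" "i + s"] ij by auto
      qed
      ultimately show ?thesis using adj by simp
    qed
    ultimately show ?thesis using f(1) by (simp add: cycle_enum_def)
  qed
  have "C = (\<lambda>i. f (i + s)) ` {..<c}" for s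
  proof -
    have "(\<lambda>i. f (i + s)) ` {..<c} \<subseteq> C" using fC by auto
    moreover have "card ((\<lambda>i. f (i + s)) ` {..<c}) = card C"
      using enum[of s] f(2) unfolding f(4) by (simp add: cycle_enum_def card_image)
    moreover have "finite C" by (simp add: f(4))
    ultimately show ?thesis using card_subset_eq[of C "(\<lambda>i. f (i + s)) ` {..<c}"] by simp
  qed
  then show ?thesis using that[of f] enum grows nochord f(3,4) c by simp
qed

section \<open>Recognizing non-trivial trees\<close>

text \<open>As the cycle has no chords, an edge at a cycle vertex survives the deletion of the cycle
  edges exactly when it leaves the cycle.\<close>

lemma num_nontrivial_trees_eq:
  assumes G: "pair_graph G" "connected (with_proj G)" "unicyclic G"
  defines "C \<equiv> pverts (the_cycle G)"
  shows "num_nontrivial_trees G = card {v \<in> C. \<exists>u\<in>pverts G - C. (v, u) \<in> parcs G}"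
proof -
  interpret pair_graph G by fact
  obtain f :: "nat \<Rightarrow> 'a" where nochord: "parcs G \<inter> C \<times> C = parcs (the_cycle G)"
      and CV: "grows (parcs G) C (pverts G)"
    using unicyclic_structure[OF G] unfolding C_def by metis
  let ?D = "delete_cycle_edges G"
  have symC: "sym (parcs (the_cycle G))"
    unfolding nochord[symmetric] using sym_parcs[OF G(1)] by (auto simp: sym_def)
  interpret D: pair_graph ?D
  proof
    show "finite (pverts ?D)" "finite (parcs ?D)"
      using pair_finite_verts pair_finite_arcs by (simp_all add: delete_cycle_edges_def)
    show "symmetric (with_proj ?D)"
      using arcs_symmetric symC by (auto simp: symmetric_def delete_cycle_edges_def sym_def)
  qed (auto simp: delete_cycle_edges_def dest: in_arcsD1 in_arcsD2 no_loops')
  have D: "pverts ?D = pverts G" "parcs ?D = parcs G - parcs (the_cycle G)"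
    by (simp_all add: delete_cycle_edges_def)
  have "1 < card (verts (attached_tree G v)) \<longleftrightarrow> (\<exists>u\<in>pverts G - C. (v, u) \<in> parcs G)"
    if v: "v \<in> C" for v
  proof -
    have vV: "v \<in> pverts G" using v grows_superset[OF CV] by auto
    have verts: "verts (attached_tree G v) = D.scc_of v"
      by (simp add: attached_tree_def)
    have scc: "D.scc_of v \<subseteq> pverts G"
      using D.reachable_in_verts(2) by (auto simp: D.scc_of_def D(1))
    have self: "v \<in> D.scc_of v" using D.in_scc_of_self vV D(1) by simp
    show ?thesis
    proof
      assume "1 < card (verts (attached_tree G v))"
      then have "D.scc_of v \<noteq> {v}" using verts by auto
      then obtain w where w: "w \<in> D.scc_of v" "w \<noteq> v" using self by auto
      then have "(v, w) \<in> (parcs ?D)\<^sup>*" by (auto simp: D.scc_of_def D.reachable_conv)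
      \<comment> \<open>The first arc of a path from \<open>v\<close> to \<open>w\<close> already
        shows that \<open>v\<close> has a surviving edge.\<close>
      then obtain u where u: "(v, u) \<in> parcs ?D"
        using w(2) by (metis converse_rtranclE)
      then have "u \<notin> C" using v nochord D(2) by auto
      then show "\<exists>u\<in>pverts G - C. (v, u) \<in> parcs G" using u D(2) in_arcsD2 by auto
    next
      assume "\<exists>u\<in>pverts G - C. (v, u) \<in> parcs G"
      then obtain u where u: "u \<notin> C" "(v, u) \<in> parcs G" by auto
      then have "(v, u) \<in> parcs ?D" using nochord D(2) by auto
      then have "v \<rightarrow>\<^sup>*\<^bsub>with_proj ?D\<^esub> u" by auto
      then have "u \<in> D.scc_of v" by (rule D.scc_ofI_reachable')
      then have "card {v, u} \<le> card (D.scc_of v)"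
        using self scc pair_finite_verts by (intro card_mono) (auto intro: finite_subset)
      moreover have "v \<noteq> u" using v u by auto
      ultimately show "1 < card (verts (attached_tree G v))" by (simp add: verts)
    qed
  qed
  then have "{v \<in> C. 1 < card (verts (attached_tree G v))} = {v \<in> C. \<exists>u\<in>pverts G - C. (v, u) \<in> parcs G}"
    by blast
  then show ?thesis unfolding num_nontrivial_trees_def C_def by simp
qed

section \<open>Recovering parameters from the chromatic symmetric function\<close>

lemma lookup_coloring_monomial:
  assumes "finite (pverts G)"
  shows "Poly_Mapping.lookup (coloring_monomial G \<kappa>) k = card {v \<in> pverts G. \<kappa> v = k}"
  using assms unfolding coloring_monomial_def lookup_sum
  by (simp add: lookup_single when_def sum.If_cases Int_def)

text \<open>The keys of the monomial are the colors used, so restricting the colors is a condition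
  on the monomial alone.\<close>

lemma colorings_conv_monomial:
  assumes "pair_graph G"
  shows "colorings (parcs G) (pverts G) A
    = {\<kappa> \<in> proper_colorings G. Poly_Mapping.keys (coloring_monomial G \<kappa>) \<subseteq> A}"
proof -
  interpret pair_graph G by fact
  have "Poly_Mapping.keys (coloring_monomial G \<kappa>) = \<kappa> ` pverts G" for \<kappa>
    using pair_finite_verts
    by (auto simp: in_keys_iff lookup_coloring_monomial card_gt_0_iff simp flip: neq0_conv)
  moreover have "(\<forall>u\<in>pverts G. \<forall>v\<in>pverts G. (u, v) \<in> parcs G \<longrightarrow> \<kappa> u \<noteq> \<kappa> v)
      \<longleftrightarrow> (\<forall>(u, v)\<in>parcs G. \<kappa> u \<noteq> \<kappa> v)" for \<kappa> :: "'a \<Rightarrow> nat"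
    using in_arcsD1 in_arcsD2 by blast
  ultimately show ?thesis
    by (auto simp: colorings_def proper_colorings_def PiE_iff)
qed

text \<open>Grouping colorings by monomial writes each count as a sum of coefficients;
  \<open>M\<close> is a common finite range of summation for both graphs.\<close>

lemma card_colorings_eq_if_csf_eq:
  fixes G :: "'a pair_pre_digraph" and H :: "'b pair_pre_digraph"
  assumes csf: "chromatic_symmetric_function H = chromatic_symmetric_function G"
    and fin: "finite {\<kappa> \<in> proper_colorings G. P (coloring_monomial G \<kappa>)}"
      "finite {\<kappa> \<in> proper_colorings H. P (coloring_monomial H \<kappa>)}"
  shows "card {\<kappa> \<in> proper_colorings H. P (coloring_monomial H \<kappa>)}
    = card {\<kappa> \<in> proper_colorings G. P (coloring_monomial G \<kappa>)}"
proof -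
  let ?SG = "{\<kappa> \<in> proper_colorings G. P (coloring_monomial G \<kappa>)}"
  let ?SH = "{\<kappa> \<in> proper_colorings H. P (coloring_monomial H \<kappa>)}"
  define M where "M = coloring_monomial G ` ?SG \<union> coloring_monomial H ` ?SH"
  have M: "finite M" "coloring_monomial G ` ?SG \<subseteq> M" "coloring_monomial H ` ?SH \<subseteq> M"
    using fin by (auto simp: M_def)
  have PM: "P m" if "m \<in> M" for m using that by (auto simp: M_def)
  have "card ?SH = (\<Sum>m\<in>M. card {\<kappa> \<in> ?SH. coloring_monomial H \<kappa> = m})"
    using sum.group[OF fin(2) M(1,3), of "\<lambda>_. 1::nat"] by simp
  also have "\<dots> = (\<Sum>m\<in>M. card {\<kappa> \<in> proper_colorings H. coloring_monomial H \<kappa> = m})"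
    by (intro sum.cong refl arg_cong[where f = card]) (use PM in auto)
  also have "\<dots> = (\<Sum>m\<in>M. card {\<kappa> \<in> proper_colorings G. coloring_monomial G \<kappa> = m})"
    using csf by (auto simp: chromatic_symmetric_function_def fun_eq_iff)
  also have "\<dots> = (\<Sum>m\<in>M. card {\<kappa> \<in> ?SG. coloring_monomial G \<kappa> = m})"
    by (intro sum.cong refl arg_cong[where f = card]) (use PM in auto)
  also have "\<dots> = card ?SG"
    using sum.group[OF fin(1) M(1,2), of "\<lambda>_. 1::nat"] by simp
  finally show ?thesis .
qed

text \<open>How often the color 0 occurs is the exponent of the variable with index 0, so it can be
  read off the monomial just like the set of colors.\<close>

lemma card_colorings_zero_eq_if_csf_eq:
  fixes G :: "'a pair_pre_digraph" and H :: "'b pair_pre_digraph"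
  assumes G: "pair_graph G" and H: "pair_graph H"
    and csf: "chromatic_symmetric_function H = chromatic_symmetric_function G"
    and A: "finite A"
  shows "card {\<kappa> \<in> colorings (parcs H) (pverts H) A. Q (card {v \<in> pverts H. \<kappa> v = 0})}
    = card {\<kappa> \<in> colorings (parcs G) (pverts G) A. Q (card {v \<in> pverts G. \<kappa> v = 0})}"
proof -
  interpret G: pair_graph G by fact
  interpret H: pair_graph H by fact
  define P where "P m \<longleftrightarrow> Poly_Mapping.keys m \<subseteq> A \<and> Q (Poly_Mapping.lookup m 0)" for m :: "nat \<Rightarrow>\<^sub>0 nat"
  have eqG: "{\<kappa> \<in> colorings (parcs G) (pverts G) A. Q (card {v \<in> pverts G. \<kappa> v = 0})}
      = {\<kappa> \<in> proper_colorings G. P (coloring_monomial G \<kappa>)}"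
    unfolding colorings_conv_monomial[OF G] P_def lookup_coloring_monomial[OF G.pair_finite_verts] by blast
  have eqH: "{\<kappa> \<in> colorings (parcs H) (pverts H) A. Q (card {v \<in> pverts H. \<kappa> v = 0})}
      = {\<kappa> \<in> proper_colorings H. P (coloring_monomial H \<kappa>)}"
    unfolding colorings_conv_monomial[OF H] P_def lookup_coloring_monomial[OF H.pair_finite_verts] by blast
  have "finite {\<kappa> \<in> proper_colorings G. P (coloring_monomial G \<kappa>)}"
    unfolding eqG[symmetric] using finite_colorings[OF G.pair_finite_verts A] by simp
  moreover have "finite {\<kappa> \<in> proper_colorings H. P (coloring_monomial H \<kappa>)}"
    unfolding eqH[symmetric] using finite_colorings[OF H.pair_finite_verts A] by simp
  ultimately show ?thesis
    unfolding eqG eqH using csf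
    by (intro card_colorings_eq_if_csf_eq)
qed

text \<open>The number of vertices is the degree of every monomial that occurs. An injective
  coloring of \<open>G\<close> is proper, so some monomial does occur, and it then occurs for
  \<open>H\<close> too.\<close>

lemma card_pverts_eq_if_csf_eq:
  fixes G :: "'a pair_pre_digraph" and H :: "'b pair_pre_digraph"
  assumes G: "pair_graph G" and H: "pair_graph H"
    and csf: "chromatic_symmetric_function H = chromatic_symmetric_function G"
  shows "card (pverts H) = card (pverts G)"
proof -
  interpret G: pair_graph G by fact
  interpret H: pair_graph H by fact
  obtain g :: "'a \<Rightarrow> nat" where g: "inj_on g (pverts G)"
    using finite_imp_inj_to_nat_seg[OF G.pair_finite_verts] by blast
  define \<kappa> where "\<kappa> = restrict g (pverts G)"
  have "\<kappa> u \<noteq> \<kappa> v" if "(u, v) \<in> parcs G" for u v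
    using that G.in_arcsD1[OF that] G.in_arcsD2[OF that] G.no_loops'[OF that] g
    by (auto simp: \<kappa>_def dest: inj_onD)
  moreover have "\<kappa> \<in> pverts G \<rightarrow>\<^sub>E UNIV" by (simp add: \<kappa>_def)
  ultimately have "\<kappa> \<in> proper_colorings G"
    unfolding proper_colorings_def by blast
  then have "{\<kappa>' \<in> proper_colorings G. coloring_monomial G \<kappa>' = coloring_monomial G \<kappa>} \<noteq> {}"
    by blast
  then have "chromatic_symmetric_function G (coloring_monomial G \<kappa>) \<noteq> 0"
    using finite_colorings_of_monomial[OF G.pair_finite_verts]
    by (simp add: chromatic_symmetric_function_def)
  then have "card {\<kappa>' \<in> proper_colorings H. coloring_monomial H \<kappa>' = coloring_monomial G \<kappa>} \<noteq> 0"
    unfolding csf[symmetric] by (simp add: chromatic_symmetric_function_def)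
  then have "{\<kappa>' \<in> proper_colorings H. coloring_monomial H \<kappa>' = coloring_monomial G \<kappa>} \<noteq> {}"
    by (simp only: card_eq_0_iff) blast
  then obtain \<kappa>' where \<kappa>': "coloring_monomial H \<kappa>' = coloring_monomial G \<kappa>" by blast
  define K where "K = \<kappa> ` pverts G \<union> \<kappa>' ` pverts H"
  have K: "finite K" "\<kappa> ` pverts G \<subseteq> K" "\<kappa>' ` pverts H \<subseteq> K"
    using G.pair_finite_verts H.pair_finite_verts by (auto simp: K_def)
  have "card (pverts H) = (\<Sum>k\<in>K. Poly_Mapping.lookup (coloring_monomial H \<kappa>') k)"
    using sum.group[OF H.pair_finite_verts K(1,3), of "\<lambda>_. 1::nat"]
    by (simp add: lookup_coloring_monomial[OF H.pair_finite_verts])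
  also have "\<dots> = card (pverts G)"
    unfolding \<kappa>' using sum.group[OF G.pair_finite_verts K(1,2), of "\<lambda>_. 1::nat"]
    by (simp add: lookup_coloring_monomial[OF G.pair_finite_verts])
  finally show ?thesis .
qed

section \<open>Recovering the cycle size\<close>

lemma card_colorings_unicyclic:
  assumes G: "pair_graph G" "connected (with_proj G)" "unicyclic G"
    and A: "finite A" "A \<noteq> {}"
  defines "t \<equiv> int (card A)" and "c \<equiv> cycle_size G"
  shows "int (card (colorings (parcs G) (pverts G) A))
    = ((t - 1) ^ c + (- 1) ^ c * (t - 1)) * (t - 1) ^ (card (pverts G) - c)"
proof -
  interpret pair_graph G by fact
  have R: "sym (parcs G)" "irrefl (parcs G)"
    using sym_parcs irrefl_parcs G(1) by blast+
  obtain f where f: "pverts (the_cycle G) = f ` {..<c}" "\<And>s. cycle_enum (parcs G) c (\<lambda>i. f (i + s))"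
      "grows (parcs G) (pverts (the_cycle G)) (pverts G)"
    by (rule unicyclic_structure[OF G, folded c_def]) (rule that)
  have enum: "cycle_enum (parcs G) c f" using f(2)[of 0] by simp
  have "int (card A - 1) = t - 1"
    using A by (simp add: t_def of_nat_diff card_gt_0_iff Suc_leI)
  moreover have "finite (pverts (the_cycle G))" using f(1) by simp
  moreover have "card (pverts (the_cycle G)) = c" by (simp add: c_def cycle_size_def)
  ultimately show ?thesis
    using card_colorings_grows[OF f(3) R _ A(1)] card_colorings_cycle[OF enum R A] f(1)
    by (simp add: t_def)
qed

lemma cycle_size_bounds:
  assumes G: "pair_graph G" "connected (with_proj G)" "unicyclic G"
  shows "3 \<le> cycle_size G" "pverts (the_cycle G) \<subseteq> pverts G" "cycle_size G \<le> card (pverts G)"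
proof -
  interpret pair_graph G by fact
  obtain f where f: "pverts (the_cycle G) = f ` {..<cycle_size G}"
      "\<And>s. cycle_enum (parcs G) (cycle_size G) (\<lambda>i. f (i + s))"
      "grows (parcs G) (pverts (the_cycle G)) (pverts G)"
    by (rule unicyclic_structure[OF G]) (rule that)
  show "3 \<le> cycle_size G" using f(2) by (simp add: cycle_enum_def)
  show "pverts (the_cycle G) \<subseteq> pverts G" using grows_superset[OF f(3)] .
  then show "cycle_size G \<le> card (pverts G)"
    unfolding cycle_size_def using pair_finite_verts by (rule card_mono[rotated])
qed

text \<open>With three colors, the count differs from \<open>2 ^ n\<close> by a signed power of 2
  whose exponent \<open>Suc (n - c)\<close> determines \<open>c\<close>. Absolute values dispose of
  the sign.\<close>

lemma cycle_size_eq_if_csf_eq: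
  fixes G :: "'a pair_pre_digraph" and H :: "'b pair_pre_digraph"
  assumes G: "pair_graph G" "connected (with_proj G)" "unicyclic G"
    and H: "pair_graph H" "connected (with_proj H)" "unicyclic H"
    and csf: "chromatic_symmetric_function H = chromatic_symmetric_function G"
  shows "cycle_size H = cycle_size G"
proof -
  define c c' n where "c = cycle_size G" and "c' = cycle_size H" and "n = card (pverts G)"
  have n: "card (pverts H) = n"
    using card_pverts_eq_if_csf_eq[OF G(1) H(1) csf] by (simp add: n_def)
  have le: "c \<le> n" "c' \<le> n"
    using cycle_size_bounds(3)[OF G] cycle_size_bounds(3)[OF H] n by (simp_all add: c_def c'_def n_def)
  have expand: "(2 ^ k + (- 1) ^ k * 2) * 2 ^ (n - k) = 2 ^ n + (- 1) ^ k * (2::int) ^ Suc (n - k)"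
    if "k \<le> n" for k
  proof -
    have "(2::int) ^ n = 2 ^ k * 2 ^ (n - k)" using that by (simp flip: power_add)
    then show ?thesis by (simp add: algebra_simps)
  qed
  have "card (colorings (parcs H) (pverts H) {0..2}) = card (colorings (parcs G) (pverts G) {0..2})"
    using card_colorings_zero_eq_if_csf_eq[OF G(1) H(1) csf, of "{0..2}" "\<lambda>_. True"] by simp
  then have "(2 ^ c' + (- 1) ^ c' * 2) * 2 ^ (n - c') = (2 ^ c + (- 1) ^ c * 2) * (2::int) ^ (n - c)"
    using card_colorings_unicyclic[OF G, of "{0..2}"] card_colorings_unicyclic[OF H, of "{0..2}"] n
    by (simp add: c_def c'_def n_def)
  then have "(- 1) ^ c' * (2::int) ^ Suc (n - c') = (- 1) ^ c * 2 ^ Suc (n - c)"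
    unfolding expand[OF le(1)] expand[OF le(2)] by simp
  then have "\<bar>(- 1) ^ c' * (2::int) ^ Suc (n - c')\<bar> = \<bar>(- 1) ^ c * 2 ^ Suc (n - c)\<bar>"
    by (rule arg_cong)
  then have "(2::int) ^ Suc (n - c') = 2 ^ Suc (n - c)"
    by (simp only: abs_mult power_abs abs_neg_one power_one mult_1 abs_numeral)
  then have "Suc (n - c') = Suc (n - c)" by (subst (asm) power_inject_exp) auto
  then show ?thesis using le by (simp add: c_def c'_def)
qed

section \<open>Recovering the number of trees modulo \<open>c - 1\<close>\<close>

lemma sum_card_colorings_delete_mod:
  assumes G: "pair_graph G" "connected (with_proj G)" "unicyclic G"
  defines "t \<equiv> cycle_size G - 1"
  shows "(\<Sum>v\<in>pverts G. card (colorings (parcs G) (pverts G - {v}) {1..t})) mod t\<^sup>2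
    = ((cycle_size G - num_nontrivial_trees G) * (t * (t - 1) ^ (card (pverts G) - 2))) mod t\<^sup>2"
proof -
  interpret pair_graph G by fact
  let ?E = "parcs G" and ?V = "pverts G" and ?A = "{1..t}"
  define c C where "c = cycle_size G" and "C = pverts (the_cycle G)"
  have R: "sym ?E" "irrefl ?E"
    using sym_parcs irrefl_parcs G(1) by blast+
  obtain f where f: "C = f ` {..<c}" "\<And>i. f (i + c) = f i" "\<And>s. cycle_enum ?E c (\<lambda>i. f (i + s))"
      "\<And>s. C = (\<lambda>i. f (i + s)) ` {..<c}" "grows ?E C ?V"
    by (rule unicyclic_structure[OF G, folded c_def C_def]) (rule that)
  have c: "3 \<le> c" "card C = c" "Suc t = c"
    using cycle_size_bounds(1)[OF G] by (simp_all add: c_def C_def t_def cycle_size_def)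
  have finC: "finite C" using f(1) by simp
  have two: "2 \<le> card C" using c by simp
  have enum: "cycle_enum ?E c f" using f(3)[of 0] by simp
  have path: "card (colorings ?E (C - {v}) ?A) = card ?A * (card ?A - 1) ^ (card C - 2)"
    if "v \<in> C" for v
  proof -
    text \<open>Rotate the enumeration of the cycle so that the deleted vertex comes last.\<close>
    obtain i where i: "v = f i" using \<open>v \<in> C\<close> f(1) by auto
    define g where "g j = f (j + Suc i)" for j
    have g: "cycle_enum ?E c g" "C = g ` {..<c}" unfolding g_def using f(3,4) by blast+
    define k where "k = c - 2"
    have k: "c = Suc (Suc k)" using c(1) by (simp add: k_def)
    have "g (Suc k) = f (i + c)" by (simp add: g_def k ac_simps)
    then have v: "v = g (Suc k)" using f(2)[of i] i by simp
    have "C = insert v (g ` {..<Suc k})"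
      unfolding g(2) v k by (simp add: lessThan_Suc[of "Suc k"])
    moreover have "v \<notin> g ` {..<Suc k}"
      unfolding v using k by (intro cycle_enum_notin[OF g(1)]) simp
    ultimately have "C - {v} = g ` {..<Suc k}" by auto
    \<comment> \<open>The remaining path has \<open>Suc k\<close>, that is, \<open>c - 1\<close>
      vertices.\<close>
    then show ?thesis
      using card_colorings_subpath[OF g(1) R, of ?A k] k c(2) by simp
  qed
  have cyc: "(card ?A)\<^sup>2 dvd card (colorings ?E C ?A)"
    unfolding f(1) using c by (intro square_dvd_card_colorings_cycle[OF enum R]) auto
  \<comment> \<open>The cycle vertices with trivial trees, the only ones whose summands need not
    vanish modulo the square of \<open>t\<close>.\<close>
  define good where "good = {v \<in> C. \<forall>u\<in>?V - C. (v, u) \<notin> ?E}"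
  have CV: "C \<subseteq> ?V" using grows_superset[OF f(5)] .
  have del: "if v \<in> good
     then card (colorings ?E (?V - {v}) ?A) = t * (t - 1) ^ (card ?V - 2)
     else t\<^sup>2 dvd card (colorings ?E (?V - {v}) ?A)" if "v \<in> ?V" for v
  proof -
    have "card ?A dvd card (colorings ?E (?V - {v}) ?A) \<and>
      (if v \<in> C \<and> (\<forall>u\<in>?V - C. (v, u) \<notin> ?E)
       then card (colorings ?E (?V - {v}) ?A) = card ?A * (card ?A - 1) ^ (card ?V - 2)
       else (card ?A)\<^sup>2 dvd card (colorings ?E (?V - {v}) ?A))"
      by (rule grows_colorings_delete[OF f(5) R finC finite_atLeastAtMost two _ cyc that]) (rule path)
    then show ?thesis
      unfolding good_def mem_Collect_eq card_atLeastAtMost diff_Suc_1 by (rule conjunct2)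
  qed
  have goodV: "good \<subseteq> ?V" using CV by (auto simp: good_def)
  have "card good = c - num_nontrivial_trees G"
  proof -
    let ?B = "{v \<in> C. \<exists>u\<in>?V - C. (v, u) \<in> ?E}"
    have "good = C - ?B" by (auto simp: good_def)
    then have "card good = card C - card ?B" using finC by (simp add: card_Diff_subset)
    then show ?thesis using num_nontrivial_trees_eq[OF G] c by (simp add: C_def)
  qed
  moreover have "(\<Sum>v\<in>?V. card (colorings ?E (?V - {v}) ?A))
      = (\<Sum>v\<in>good. card (colorings ?E (?V - {v}) ?A)) + (\<Sum>v\<in>?V - good. card (colorings ?E (?V - {v}) ?A))"
    using sum.subset_diff[OF goodV pair_finite_verts] by (simp only: add.commute)
  moreover have "(\<Sum>v\<in>good. card (colorings ?E (?V - {v}) ?A))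
      = (\<Sum>v\<in>good. t * (t - 1) ^ (card ?V - 2))"
  proof (intro sum.cong refl)
    fix v assume v: "v \<in> good"
    show "card (colorings ?E (?V - {v}) ?A) = t * (t - 1) ^ (card ?V - 2)"
      using del[OF subsetD[OF goodV v]] unfolding if_P[OF v] .
  qed
  moreover have "t\<^sup>2 dvd (\<Sum>v\<in>?V - good. card (colorings ?E (?V - {v}) ?A))"
  proof (rule dvd_sum)
    fix v assume v: "v \<in> ?V - good"
    show "t\<^sup>2 dvd card (colorings ?E (?V - {v}) ?A)"
      using del[of v] v by (simp only: Diff_iff if_False if_cancel simp_thms)
  qed
  ultimately show ?thesis
    by (auto simp: c_def elim!: dvdE)
qed

section \<open>Graphs that consist of their cycle only\<close>

text \<open>The first vertex attached has its neighbour in \<open>C\<close>, and later attachments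
  preserve this edge.\<close>

lemma grows_neighbour_outside:
  assumes "grows R C W" "sym R"
  shows "W = C \<or> (\<exists>y\<in>C. \<exists>x\<in>W - C. (y, x) \<in> R)"
  using assms(1)
proof (induction rule: grows.induct)
  case (step W x y)
  have "(y, x) \<in> R" "y \<in> W" using step.hyps(3) assms(2) by (auto dest: symD)
  then show ?case using step.IH step.hyps(2) by blast
qed simp

text \<open>Expresses the absence of non-trivial trees through two numbers that the chromatic
  symmetric function determines, so it transfers from \<open>H\<close> to \<open>G\<close>.\<close>

lemma num_nontrivial_trees_eq_0_iff:
  assumes G: "pair_graph G" "connected (with_proj G)" "unicyclic G"
  shows "num_nontrivial_trees G = 0 \<longleftrightarrow> card (pverts G) = cycle_size G"
proof -
  interpret pair_graph G by fact
  let ?C = "pverts (the_cycle G)"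
  have sym: "sym (parcs G)" using sym_parcs G(1) by blast
  have grows: "grows (parcs G) ?C (pverts G)"
    by (rule unicyclic_structure[OF G])
  have C: "?C \<subseteq> pverts G" by (rule cycle_size_bounds(2)[OF G])
  then have fin: "finite ?C" using pair_finite_verts by (rule finite_subset)
  have "num_nontrivial_trees G = 0 \<longleftrightarrow> \<not> (\<exists>v\<in>?C. \<exists>u\<in>pverts G - ?C. (v, u) \<in> parcs G)"
    unfolding num_nontrivial_trees_eq[OF G] using fin by auto
  also have "\<dots> \<longleftrightarrow> pverts G = ?C"
    using grows_neighbour_outside[OF grows sym] by blast
  also have "\<dots> \<longleftrightarrow> card (pverts G) = card ?C"
    using C pair_finite_verts by (metis card_subset_eq)
  finally show ?thesis by (simp add: cycle_size_def)
qed

lemma num_nontrivial_trees_le: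
  assumes G: "pair_graph G" "connected (with_proj G)" "unicyclic G"
  shows "num_nontrivial_trees G \<le> cycle_size G"
proof -
  interpret pair_graph G by fact
  have "finite (pverts (the_cycle G))"
    using cycle_size_bounds(2)[OF G] pair_finite_verts by (rule finite_subset)
  then show ?thesis
    unfolding num_nontrivial_trees_def cycle_size_def by (intro card_mono) auto
qed

theorem corollary3p10:
  fixes G :: "'a pair_pre_digraph" and H :: "'b pair_pre_digraph" and r c :: nat
  assumes "pair_graph G" and "connected (with_proj G)" and "unicyclic G"
    and "cycle_size G = c" and "num_nontrivial_trees G = r"
    and "1 < r" and "r < c"
    and "pair_graph H" and "connected (with_proj H)" and "unicyclic H"
    and "chromatic_symmetric_function H = chromatic_symmetric_function G"
  shows "num_nontrivial_trees H = r"
proof -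
  interpret G: pair_graph G by fact
  interpret H: pair_graph H by fact
  note G = assms(1-3) and H = assms(8-10) and csf = assms(11)
  define r' n t where "r' = num_nontrivial_trees H" and "n = card (pverts G)" and "t = c - 1"
  have c': "cycle_size H = c" using cycle_size_eq_if_csf_eq[OF G H csf] assms(4) by simp
  have n': "card (pverts H) = n" using card_pverts_eq_if_csf_eq[OF G(1) H(1) csf] by (simp add: n_def)
  have t: "2 \<le> t" "c = Suc t" using cycle_size_bounds(1)[OF G] assms(4) by (simp_all add: t_def)
  have r': "r' \<le> c" using num_nontrivial_trees_le[OF H] c' by (simp add: r'_def)
  have R: "irrefl (parcs G)" "irrefl (parcs H)"
    using irrefl_parcs G(1) H(1) by blast+
  have "(\<Sum>v\<in>pverts H. card (colorings (parcs H) (pverts H - {v}) {1..t}))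
      = (\<Sum>v\<in>pverts G. card (colorings (parcs G) (pverts G - {v}) {1..t}))"
    unfolding card_colorings_zero_once[OF G.pair_finite_verts R(1), symmetric]
      card_colorings_zero_once[OF H.pair_finite_verts R(2), symmetric]
    by (rule card_colorings_zero_eq_if_csf_eq[OF G(1) H(1) csf]) simp
  then have "((c - r) * (t * (t - 1) ^ (n - 2))) mod t\<^sup>2 = ((c - r') * (t * (t - 1) ^ (n - 2))) mod t\<^sup>2"
    using sum_card_colorings_delete_mod[OF G] sum_card_colorings_delete_mod[OF H] assms(4,5) c' n'
    by (simp add: r'_def n_def t_def)
  then have "int ((c - r) * (t * (t - 1) ^ (n - 2))) mod int (t\<^sup>2)
      = int ((c - r') * (t * (t - 1) ^ (n - 2))) mod int (t\<^sup>2)"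
    by (simp only: zmod_int[symmetric])
  then have "int t * int t dvd (int (c - r) - int (c - r')) * (int t * int (t - 1) ^ (n - 2))"
    by (simp only: mod_eq_dvd_iff of_nat_mult of_nat_power left_diff_distrib power2_eq_square)
  then have "int t dvd (int (c - r) - int (c - r')) * int (t - 1) ^ (n - 2)"
    using t by (simp add: mult.left_commute[of _ "int t"])
  moreover have "coprime t (t - 1)" using t by (intro coprime_diff_one_right_nat) simp
  then have "coprime (int t) (int (t - 1) ^ (n - 2))"
    by (simp only: coprime_int_iff coprime_power_right_iff simp_thms)
  ultimately have "int t dvd int (c - r) - int (c - r')"
    by (simp add: coprime_dvd_mult_left_iff)
  then have dvd: "int t dvd int r' - int r"
    using r' assms(7) by (simp add: of_nat_diff)
  show ?thesis
  proof (rule ccontr)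
    assume "num_nontrivial_trees H \<noteq> r"
    then have "int r' - int r \<noteq> 0" by (simp add: r'_def)
    \<comment> \<open>As \<open>r \<ge> 2\<close> and \<open>r' \<le> t + 1\<close>, the difference
      \<open>r' - r\<close> is less than \<open>t\<close>. So \<open>r' \<le> r - t\<close>, and
      \<open>r \<le> t\<close> leaves only \<open>r' = 0\<close>.\<close>
    then have "int t \<le> \<bar>int r' - int r\<bar>" using dvd_imp_le_int[OF _ dvd] by simp
    then have "r' = 0" using r' t assms(6,7) by arith
    \<comment> \<open>If \<open>H\<close> is just a cycle, then the equal vertex counts and cycle
      sizes make \<open>G\<close> one too, contradicting \<open>1 < r\<close>.\<close>
    then have "n = c" using num_nontrivial_trees_eq_0_iff[OF H] c' n' by (simp add: r'_def)
    then have "r = 0" using num_nontrivial_trees_eq_0_iff[OF G] assms(4,5) by (simp add: n_def)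
    then show False using assms(6) by simp
  qed
qed

end
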